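(* Let $\mathcal{P}:\mathscr{M}\to\mathbb{R}$ be of the form $$\mathcal{P}(\eta)=\mathcal{P}_1(T_\#\eta)+\mathcal{P}_2({\pi_2}_\#\eta),$$ where $T:\mathbb{R}^n\times\mathbb{R}^n\to\mathbb{R}^n$, $T(x,y)=x-y$, and suppose the functionals $\eta\mapsto\mathcal{P}_1(T_\#\eta)$ and $\eta\mapsto\mathcal{P}_2({\pi_2}_\#\eta)$ from $\mathscr{M}$ to $\mathbb{R}$ satisfy Assumption (A2) (see context) with functions $h_\eta,k_\eta:\mathbb{R}^n\to\mathbb{R}$ respectively, i.e. with kernels $(x,y)\mapsto h_\eta(x-y)$ and $(x,y)\mapsto k_\eta(y)$. If $\mathcal{P}$ satisfies Assumption (A1) (see context), then it also satisfies Assumption (A2), with $$p_\eta(x,y)=h_\eta(x-y)+k_\eta(y).$$ Moreover, if in addition $n=1$ and (i) for every $\nu\in\pi_2(\mathcal{S})$, $\Pi(\mu,\nu)\cap\mathscr{M}\subset\mathcal{S}$, (ii) $h_{\eta^{*}}$ is strictly convex for every optimal treaty $\eta^{*}$, and (iii) the distribution $\mu$ of $X$ is continuous, then for every optimal treaty $\eta^{*}$ and every $\nu\in\pi_2(\mathcal{S})$ there exists a unique optimal Monge map for the problem $$\mathcal{C}(\mu,\nu)=\min_{\eta\in\Pi(\mu,\nu)\cap\mathcal{S}}\int q_{\eta^{*}}(x,y)\,\eta(dx,dy),$$ where $q_{\eta^{*}}=p_{\eta^{*}}$ on $\mathcal{A}_R$ and $q_{\eta^{*}}=+\infty$ elsewhere.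 In particular, every optimal reinsurance contract is deterministic.
   Context: Fix $n\ge 1$ and let $\mu$ be a probability measure on $\mathbb{R}^n_+=[0,\infty)^n$ (the law of a random vector $X$), absolutely continuous with respect to Lebesgue measure, each of whose one-dimensional marginals has finite first moment. Let $\mathcal{A}_R=\{(x,y)\in\mathbb{R}^n\times\mathbb{R}^n : 0\le y_i\le x_i,\ i=1,\dots,n\}$. A (random) reinsurance treaty (or contract) is a Borel probability measure $\eta$ on $\mathbb{R}^n_+\times\mathbb{R}^n_+$ whose first marginal is $\mu$ and which satisfies $\eta(\mathcal{A}_R)=1$; $\mathscr{M}$ is the (convex) set of all reinsurance treaties, with the weak topology. $\mathcal{S}\subseteq\mathscr{M}$ is the set of admissible treaties. Standing assumptions: $\mathcal{P}$ is lower semi-continuous and $\mathcal{S}$ is closed. An optimal treaty (optimal reinsurance contract) is $\eta^{*}\in\mathcal{S}$ with $\mathcal{P}(\eta^{*})=\min_{\eta\in\mathcal{S}}\mathcal{P}(\eta)$. A treaty is deterministic if it has the form $(\mathrm{Id},f)_\#\mu$ for a measurable map $f:\mathbb{R}^n\to\mathbb{R}^n$. $\pi_1,\pi_2:\mathbb{R}^n\times\mathbb{R}^n\to\mathbb{R}^n$ are the projections to the first and second factor, $f_\#\eta$ denotes push-forward, $\pi_2(\mathcal{S})=\{{\pi_2}_\#\eta:\eta\in\mathcal{S}\}$, and $\Pi(\mu,\nu)$ is the set of probability measures on $\mathbb{R}^n\times\mathbb{R}^n$ with marginals $\mu$ and $\nu$. An optimal Monge map for the problem $\mathcal{C}(\mu,\nu)$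 is a measurable map $g$ such that $(\mathrm{Id},g)_\#\mu$ belongs to $\Pi(\mu,\nu)\cap\mathcal{S}$ and attains the minimum; uniqueness is up to $\mu$-null sets. The (one-sided) directional derivative is $d\mathcal{F}(\eta;h)=\lim_{t\to 0^+}\frac{\mathcal{F}(\eta+th)-\mathcal{F}(\eta)}{t}$, whenever the terms are defined and the limit exists. Assumption (A1) for $\mathcal{P}$: if $\eta^{*}\in\mathcal{S}$ is an optimal reinsurance contract, then for every $\eta\in\mathcal{S}$ and $0\le t\le 1$, $\mathcal{P}(\eta^{*})\le\mathcal{P}((1-t)\eta^{*}+t\eta)$. Assumption (A2) for a functional $\mathcal{F}:\mathscr{M}\to\mathbb{R}$: for every $\eta\in\mathcal{S}$, $d\mathcal{F}(\eta;\cdot)$ exists for every direction in $\mathcal{S}-\eta=\{\vartheta-\eta:\vartheta\in\mathcal{S}\}$ and there is a measurable function (kernel) $p_\eta:\mathbb{R}^n\times\mathbb{R}^n\to\mathbb{R}$, integrable with respect to every element of $\mathcal{S}$, such that $d\mathcal{F}(\eta;\vartheta-\eta)=\int p_\eta(x,y)\,(\vartheta-\eta)(dx,dy)$ for every $\vartheta\in\mathcal{S}$. *)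

theory Defs
  imports "HOL-Probability.Probability"
begin

section \<open>Treaties and the weak topology\<close>

definition loss_distribution :: "(real ^ 'n) measure \<Rightarrow> bool" where
  "loss_distribution \<mu> \<longleftrightarrow>
     prob_space \<mu> \<and> sets \<mu> = sets borel \<and>
     (AE x in \<mu>. \<forall>i. 0 \<le> x $ i) \<and>
     absolutely_continuous lborel \<mu> \<and>
     (\<forall>i. integrable \<mu> (\<lambda>x. x $ i))"

definition AR :: "((real ^ 'n) \<times> (real ^ 'n)) set" where
  "AR = {(x, y). \<forall>i. 0 \<le> y $ i \<and> y $ i \<le> x $ i}"

text \<open>Measures on the product of two copies of the nonnegative orthant are represented as Borel
  measures on the whole space. No separate support condition is needed, since \<^const>\<open>AR\<close> is
  contained in that product.\<close>

definition treaties :: "(real ^ 'n) measure \<Rightarrow> ((real ^ 'n) \<times> (real ^ 'n)) measure set" where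
  "treaties \<mu> = {\<eta>. prob_space \<eta> \<and> sets \<eta> = sets borel \<and> distr \<eta> borel fst = \<mu> \<and> measure \<eta> AR = 1}"

definition couplings ::
    "(real ^ 'n) measure \<Rightarrow> (real ^ 'n) measure \<Rightarrow> ((real ^ 'n) \<times> (real ^ 'n)) measure set" where
  "couplings \<mu> \<nu> = {\<eta>. prob_space \<eta> \<and> sets \<eta> = sets borel \<and>
                         distr \<eta> borel fst = \<mu> \<and> distr \<eta> borel snd = \<nu>}"

definition deterministic :: "(real ^ 'n) measure \<Rightarrow> ((real ^ 'n) \<times> (real ^ 'n)) measure \<Rightarrow> bool" where
  "deterministic \<mu> \<eta> \<longleftrightarrow> (\<exists>f \<in> borel_measurable borel. \<eta> = distr \<mu> borel (\<lambda>x. (x, f x)))"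

text \<open>The weak topology on a set of measures: the coarsest one for which integration of every
  bounded continuous function is continuous.\<close>

definition weak_topology :: "'a::topological_space measure set \<Rightarrow> 'a measure topology" where
  "weak_topology \<M> = topology_generated_by
     {{\<eta> \<in> \<M>. (\<integral>z. f z \<partial>\<eta>) \<in> U} | (f :: 'a \<Rightarrow> real) U.
        continuous_on UNIV f \<and> bounded (range f) \<and> open U}"

definition lower_semicontinuous_map :: "'a topology \<Rightarrow> ('a \<Rightarrow> real) \<Rightarrow> bool" where
  "lower_semicontinuous_map X F \<longleftrightarrow> (\<forall>c. openin X {x \<in> topspace X. c < F x})"

lemma topspace_weak_topology [simp]: "topspace (weak_topology \<M>) = \<M>"
proof -
  have "\<M> \<in> {{\<eta> \<in> \<M>. (\<integral>z. f z \<partial>\<eta>) \<in> U} | (f :: 'a \<Rightarrow> real) U.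
        continuous_on UNIV f \<and> bounded (range f) \<and> open U}"
    by (rule CollectI, rule exI[of _ "\<lambda>_. 0"], rule exI[of _ UNIV]) auto
  then show ?thesis
    unfolding weak_topology_def topology_generated_by_topspace by blast
qed

definition optimal_treaty :: "('a measure \<Rightarrow> real) \<Rightarrow> 'a measure set \<Rightarrow> 'a measure \<Rightarrow> bool" where
  "optimal_treaty P S \<eta> \<longleftrightarrow> \<eta> \<in> S \<and> (\<forall>\<theta>\<in>S. P \<eta> \<le> P \<theta>)"

section \<open>Mixtures, directional derivatives and the two assumptions\<close>

text \<open>The measure $(1-t)\eta + t\vartheta$, for $0 \le t \le 1$.\<close>

definition mixture :: "real \<Rightarrow> 'a measure \<Rightarrow> 'a measure \<Rightarrow> 'a measure" where
  "mixture t \<eta> \<theta> = measure_of (space \<eta>) (sets \<eta>)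
     (\<lambda>A. ennreal (1 - t) * emeasure \<eta> A + ennreal t * emeasure \<theta> A)"

text \<open>Directions are signed measures, represented by their set functions. The perturbed measure is
  $\eta + t h$; it has the intended values only if the set function $\eta + t h$ is nonnegative and
  countably additive, as it is for $h = \vartheta - \eta$ and small $t > 0$.\<close>

definition signed_diff :: "'a measure \<Rightarrow> 'a measure \<Rightarrow> 'a set \<Rightarrow> real" where
  "signed_diff \<theta> \<eta> = (\<lambda>A. measure \<theta> A - measure \<eta> A)"

definition perturb :: "'a measure \<Rightarrow> real \<Rightarrow> ('a set \<Rightarrow> real) \<Rightarrow> 'a measure" where
  "perturb \<eta> t h = measure_of (space \<eta>) (sets \<eta>) (\<lambda>A. ennreal (measure \<eta> A + t * h A))"

definition has_directional_derivative ::
    "('a measure \<Rightarrow> real) \<Rightarrow> real \<Rightarrow> 'a measure \<Rightarrow> ('a set \<Rightarrow> real) \<Rightarrow> bool" where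
  "has_directional_derivative F d \<eta> h \<longleftrightarrow>
     ((\<lambda>t. (F (perturb \<eta> t h) - F \<eta>) / t) \<longlongrightarrow> d) (at_right 0)"

definition assumption_A1 :: "'a measure set \<Rightarrow> ('a measure \<Rightarrow> real) \<Rightarrow> bool" where
  "assumption_A1 S P \<longleftrightarrow>
     (\<forall>\<eta>'. optimal_treaty P S \<eta>' \<longrightarrow>
        (\<forall>\<eta>\<in>S. \<forall>t. 0 \<le> t \<and> t \<le> 1 \<longrightarrow> P \<eta>' \<le> P (mixture t \<eta>' \<eta>)))"

text \<open>The integral against the signed measure $\vartheta - \eta$ is the difference of the two
  integrals, both of which exist.\<close>

definition assumption_A2_with ::
    "'a::topological_space measure set \<Rightarrow> ('a measure \<Rightarrow> real) \<Rightarrow> ('a measure \<Rightarrow> 'a \<Rightarrow> real) \<Rightarrow> bool" where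
  "assumption_A2_with S F p \<longleftrightarrow>
     (\<forall>\<eta>\<in>S. p \<eta> \<in> borel_measurable borel \<and> (\<forall>\<theta>\<in>S. integrable \<theta> (p \<eta>)) \<and>
        (\<forall>\<theta>\<in>S. has_directional_derivative F
            ((\<integral>z. p \<eta> z \<partial>\<theta>) - (\<integral>z. p \<eta> z \<partial>\<eta>)) \<eta> (signed_diff \<theta> \<eta>)))"

lemma sets_mixture [simp]: "sets (mixture t \<eta> \<theta>) = sets \<eta>"
  by (simp add: mixture_def)

lemma emeasure_mixture:
  assumes "sets \<theta> = sets \<eta>" "A \<in> sets \<eta>"
  shows "emeasure (mixture t \<eta> \<theta>) A = ennreal (1 - t) * emeasure \<eta> A + ennreal t * emeasure \<theta> A"
  unfolding mixture_def
proof (rule emeasure_measure_of_sigma)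
  show "sigma_algebra (space \<eta>) (sets \<eta>)" ..
  show "positive (sets \<eta>) (\<lambda>A. ennreal (1 - t) * emeasure \<eta> A + ennreal t * emeasure \<theta> A)"
    by (simp add: positive_def)
  show "countably_additive (sets \<eta>) (\<lambda>A. ennreal (1 - t) * emeasure \<eta> A + ennreal t * emeasure \<theta> A)"
  proof (rule countably_additiveI)
    fix B :: "nat \<Rightarrow> 'a set"
    assume B: "range B \<subseteq> sets \<eta>" "disjoint_family B" "(\<Union>i. B i) \<in> sets \<eta>"
    then have "range B \<subseteq> sets \<theta>"
      using assms(1) by simp
    with B show "(\<Sum>i. ennreal (1 - t) * emeasure \<eta> (B i) + ennreal t * emeasure \<theta> (B i)) =
        ennreal (1 - t) * emeasure \<eta> (\<Union>i. B i) + ennreal t * emeasure \<theta> (\<Union>i. B i)"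
      by (simp add: suminf_add[symmetric] ennreal_suminf_cmult suminf_emeasure)
  qed
qed (fact assms(2))

lemma perturb_signed_diff:
  assumes "prob_space \<eta>" "prob_space \<theta>" "0 \<le> t" "t \<le> 1"
  shows "perturb \<eta> t (signed_diff \<theta> \<eta>) = mixture t \<eta> \<theta>"
proof -
  interpret \<eta>: prob_space \<eta> by fact
  interpret \<theta>: prob_space \<theta> by fact
  have "ennreal (measure \<eta> A + t * signed_diff \<theta> \<eta> A) =
      ennreal (1 - t) * emeasure \<eta> A + ennreal t * emeasure \<theta> A" for A
  proof -
    have "measure \<eta> A + t * signed_diff \<theta> \<eta> A = (1 - t) * measure \<eta> A + t * measure \<theta> A"
      by (simp add: signed_diff_def algebra_simps)
    then show ?thesis
      using assms(3,4)
      by (simp add: \<eta>.emeasure_eq_measure \<theta>.emeasure_eq_measure ennreal_mult)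
  qed
  then show ?thesis
    by (simp add: perturb_def mixture_def)
qed

definition strictly_convex :: "('a::real_vector \<Rightarrow> real) \<Rightarrow> bool" where
  "strictly_convex f \<longleftrightarrow>
     (\<forall>x y t. x \<noteq> y \<and> 0 < t \<and> t < 1 \<longrightarrow>
        f ((1 - t) *\<^sub>R x + t *\<^sub>R y) < (1 - t) * f x + t * f y)"

section \<open>The transport problem with constrained cost\<close>

definition constrained_cost :: "((real ^ 'n) \<times> (real ^ 'n) \<Rightarrow> real) \<Rightarrow> (real ^ 'n) \<times> (real ^ 'n) \<Rightarrow> ereal" where
  "constrained_cost p z = (if z \<in> AR then ereal (p z) else \<infinity>)"

text \<open>Integral of an extended real function, as positive part minus negative part
  (\<^const>\<open>e2ennreal\<close> sends negative values to \<open>0\<close>).\<close>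

definition ereal_integral :: "'a measure \<Rightarrow> ('a \<Rightarrow> ereal) \<Rightarrow> ereal" where
  "ereal_integral M f =
     enn2ereal (\<integral>\<^sup>+ z. e2ennreal (f z) \<partial>M) - enn2ereal (\<integral>\<^sup>+ z. e2ennreal (- f z) \<partial>M)"

lemma ereal_integral_eq_integral:
  fixes f :: "'a \<Rightarrow> real"
  assumes "integrable M f"
  shows "ereal_integral M (\<lambda>z. ereal (f z)) = ereal (\<integral>z. f z \<partial>M)"
proof -
  have e: "e2ennreal (ereal x) = ennreal x" for x
    by (simp add: ennreal_def max_def e2ennreal_def)
  have "(\<integral>\<^sup>+ z. ennreal (f z) \<partial>M) \<noteq> \<infinity>" "(\<integral>\<^sup>+ z. ennreal (- f z) \<partial>M) \<noteq> \<infinity>"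
    using assms by (auto simp: real_integrable_def)
  then obtain a b where "0 \<le> a" "0 \<le> b"
    "(\<integral>\<^sup>+ z. ennreal (f z) \<partial>M) = ennreal a" "(\<integral>\<^sup>+ z. ennreal (- f z) \<partial>M) = ennreal b"
    by (metis ennreal_cases infinity_ennreal_def)
  then show ?thesis
    using real_lebesgue_integral_def[OF assms]
    by (simp add: ereal_integral_def e enn2ereal_ennreal)
qed

definition optimal_monge_map ::
    "((real ^ 'n) \<times> (real ^ 'n)) measure set \<Rightarrow> ((real ^ 'n) \<times> (real ^ 'n) \<Rightarrow> ereal) \<Rightarrow>
     (real ^ 'n) measure \<Rightarrow> (real ^ 'n) measure \<Rightarrow> (real ^ 'n \<Rightarrow> real ^ 'n) \<Rightarrow> bool" where
  "optimal_monge_map S q \<mu> \<nu> g \<longleftrightarrow>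
     g \<in> borel_measurable borel \<and>
     distr \<mu> borel (\<lambda>x. (x, g x)) \<in> couplings \<mu> \<nu> \<inter> S \<and>
     (\<forall>\<eta> \<in> couplings \<mu> \<nu> \<inter> S.
        ereal_integral (distr \<mu> borel (\<lambda>x. (x, g x))) q \<le> ereal_integral \<eta> q)"

end

theory Submission
  imports Defs
begin

text \<open>Directional derivatives of the two summands add up, since the perturbed measures are mixtures of
treaties and hence treaties (\<open>assumption_A2_add\<close>). This is the first claim.

For one risk, the linearised cost at an optimal treaty is $h(x-y)+k(y)$ with $h$ strictly convex.
Among treaties with a given ceded marginal $\nu$ the term $k$ contributes a constant, and what
remains is optimal transport on the line with a strictly convex cost, whose only solution is the
nondecreasing map $g$ that carries $\mu$ to $\nu$. This map exists because $\mu$ has no atoms, and it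
automatically satisfies $0 \le g(x) \le x$ because $\nu$ is dominated by $\mu$
(\<open>monotone_rearrangement_exists\<close>). So its graph is a treaty, and by (i) it is admissible.

Optimality and uniqueness of $g$ (\<open>monotone_coupling_optimal\<close>) come from an explicit pair of dual
potentials. Let $\varphi' (x) = h'(x-g(x))$, with a supporting slope in place of the derivative, and
$\psi(y) = \inf_x (h(x-y)-\varphi(x))$. Then $\varphi(x)+\psi(y) \le h(x-y)$, with equality on the
graph of $g$; conversely equality at $(x,y)$ forces $y=g(x)$ wherever $g$ is continuous, by strict
convexity. Integrating this inequality against an arbitrary coupling settles the problem, except
that $\varphi$ and $\psi$ need not be integrable separately. Truncation and Fatou's lemma deal with
that (\<open>dual_pair_optimal\<close>).

Finally, let $\eta^*$ be an optimal treaty. By (A1) the directional derivatives at $\eta^*$ are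
nonnegative, so $\eta^*$ minimises its own linearised cost over all admissible treaties
(\<open>optimal_first_order_condition\<close>). The monotone treaty with the same ceded marginal is admissible
and costs no more, so the two costs agree, and uniqueness shows that $\eta^*$ is concentrated on
the graph of a map.\<close>

section \<open>Convex functions on the line\<close>

lemma strictly_convex_imp_convex_on:
  assumes "strictly_convex f"
  shows "convex_on UNIV f"
proof (rule convex_onI)
  fix t :: real and x y :: 'a
  assume t: "0 < t" "t < 1"
  show "f ((1 - t) *\<^sub>R x + t *\<^sub>R y) \<le> (1 - t) * f x + t * f y"
  proof (cases "x = y")
    case True
    have "(1 - t) *\<^sub>R y + t *\<^sub>R y = y" "(1 - t) * f y + t * f y = f y"
      by (simp_all add: algebra_simps)
    with True show ?thesis
      by simp
  next
    case False
    with assms t show ?thesis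
      unfolding strictly_convex_def by (meson less_imp_le)
  qed
qed simp

text \<open>The inner points $u+d$ and $v$ of the interval $[u, v+d]$ are mirror images of each other, with
weights $t$ and $1-t$, so the two strict convexity inequalities add up to the claim. Applied to
$h(x-y)$ this is the strict Monge condition: crossing a pair of transports makes it dearer.\<close>

lemma strictly_convex_increment_less:
  fixes h :: "real \<Rightarrow> real"
  assumes h: "strictly_convex h" and "u < v" "0 < d"
  shows "h (u + d) - h u < h (v + d) - h v"
proof -
  define t where "t = d / (v + d - u)"
  have pos: "0 < v + d - u"
    using assms by simp
  then have t: "0 < t" "t < 1" and d: "t * (v + d - u) = d"
    using assms by (auto simp: t_def)
  have "u \<noteq> v + d"
    using assms by simp
  have "u + d = (1 - t) *\<^sub>R u + t *\<^sub>R (v + d)" "v = (1 - (1 - t)) *\<^sub>R u + (1 - t) *\<^sub>R (v + d)"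
    using d by (simp_all add: algebra_simps)
  then have "h (u + d) < (1 - t) * h u + t * h (v + d)"
    "h v < (1 - (1 - t)) * h u + (1 - t) * h (v + d)"
    using h t \<open>u \<noteq> v + d\<close> unfolding strictly_convex_def by (metis diff_gt_0_iff_gt diff_less_eq less_add_same_cancel1)+
  then show ?thesis
    by (simp add: algebra_simps)
qed

lemma supporting_slope_exists:
  fixes h :: "real \<Rightarrow> real"
  assumes "convex_on UNIV h"
  obtains d where "\<And>x y. h x + d x * (y - x) \<le> h y"
proof
  show "h x + Inf ((\<lambda>t. (h x - h t) / (x - t)) ` ({x<..} \<inter> UNIV)) * (y - x) \<le> h y" for x y
    using convex_le_Inf_differential[OF assms, of x y] by simp
qed

lemma supporting_slope_mono:
  fixes h d :: "real \<Rightarrow> real"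
  assumes "\<And>x y. h x + d x * (y - x) \<le> h y"
  shows "mono d"
proof (rule monoI)
  fix x y :: real assume "x \<le> y"
  have "(d y - d x) * (y - x) \<ge> 0"
    using assms[of x y] assms[of y x] by (simp add: algebra_simps)
  with \<open>x \<le> y\<close> show "d x \<le> d y"
    by (cases "x = y") (auto simp: zero_le_mult_iff)
qed

text \<open>The increments of $d$ telescope, so on a partition into steps of length $e$ the increments of
$K$ add up to at most $e\,(d(b)-d(a))$, which tends to $0$. This recovers a convex
function from its slopes without differentiating it.\<close>

lemma eq_if_increment_le_mono_increment:
  fixes K d :: "real \<Rightarrow> real"
  assumes "a \<le> b"
    and incr: "\<And>s t. a \<le> s \<Longrightarrow> s \<le> t \<Longrightarrow> t \<le> b \<Longrightarrow> \<bar>K t - K s\<bar> \<le> (d t - d s) * (t - s)"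
  shows "K a = K b"
proof -
  define C where "C = (d b - d a) * (b - a)"
  have bound: "\<bar>K b - K a\<bar> \<le> C / real (Suc n)" for n
  proof -
    define e where "e = (b - a) / real (Suc n)"
    define s where "s i = a + real i * e" for i
    have e: "0 \<le> e" "real (Suc n) * e = b - a"
      using assms(1) by (auto simp: e_def)
    have s: "s 0 = a" "s (Suc n) = b"
      using e by (auto simp: s_def)
    have step: "a \<le> s i \<and> s i \<le> s (Suc i) \<and> s (Suc i) \<le> b \<and> s (Suc i) - s i = e" if "i < Suc n" for i
    proof -
      have "real (Suc i) * e \<le> real (Suc n) * e"
        using that e(1) by (intro mult_right_mono) auto
      then show ?thesis
        using e by (simp add: s_def algebra_simps)
    qed
    have "\<bar>K b - K a\<bar> = \<bar>\<Sum>i<Suc n. K (s (Suc i)) - K (s i)\<bar>"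
      using sum_lessThan_telescope[of "\<lambda>i. K (s i)" "Suc n"] s by simp
    also have "\<dots> \<le> (\<Sum>i<Suc n. \<bar>K (s (Suc i)) - K (s i)\<bar>)"
      by (rule sum_abs)
    also have "\<dots> \<le> (\<Sum>i<Suc n. (d (s (Suc i)) - d (s i)) * e)"
      using step incr by (intro sum_mono) (metis lessThan_iff)
    also have "\<dots> = (d b - d a) * e"
      using sum_lessThan_telescope[of "\<lambda>i. d (s i)" "Suc n"] s
      by (simp only: sum_distrib_right[symmetric])
    finally show ?thesis
      by (simp add: C_def e_def)
  qed
  have "(\<lambda>n. C / real (Suc n)) \<longlonglongrightarrow> 0"
    using LIMSEQ_Suc[OF lim_const_over_n[of C]] by simp
  then have "\<bar>K b - K a\<bar> \<le> 0"
    by (rule LIMSEQ_le_const) (use bound in auto)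
  then show ?thesis
    by simp
qed

lemma bounded_measurable_integrable_on:
  fixes f :: "real \<Rightarrow> real"
  assumes "f \<in> borel_measurable borel" "\<And>x. x \<in> {a..b} \<Longrightarrow> \<bar>f x\<bar> \<le> B"
  shows "f integrable_on {a..b}"
proof (rule measurable_bounded_by_integrable_imp_integrable_real)
  show "f \<in> borel_measurable (lebesgue_on {a..b})"
    using assms(1) by (intro measurable_restrict_space1 measurable_completion) simp
qed (use assms in auto)

text \<open>Between $s$ and $t$ both $h(t)-h(s)$ and $\int_s^t d$ lie between $d(s)(t-s)$ and $d(t)(t-s)$, so
their difference has the small increments that force a function to be constant.\<close>

lemma supporting_slope_has_integral:
  fixes h d :: "real \<Rightarrow> real"
  assumes slope: "\<And>x y. h x + d x * (y - x) \<le> h y" and "a \<le> b"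
  shows "(d has_integral (h b - h a)) {a..b}"
proof -
  have mono: "mono d"
    using slope by (rule supporting_slope_mono)
  have int: "d integrable_on {s..t}" for s t
  proof (rule bounded_measurable_integrable_on)
    show "d \<in> borel_measurable borel"
      using mono by (rule borel_measurable_mono)
    show "\<bar>d x\<bar> \<le> \<bar>d s\<bar> + \<bar>d t\<bar>" if "x \<in> {s..t}" for x
      using monoD[OF mono, of s x] monoD[OF mono, of x t] that by auto
  qed
  define K where "K x = integral {a..x} d - h x" for x
  have "K a = K b"
  proof (rule eq_if_increment_le_mono_increment[OF \<open>a \<le> b\<close>])
    fix s t assume st: "a \<le> s" "s \<le> t" "t \<le> b"
    have "integral {a..t} d - integral {a..s} d = integral {s..t} d"
      using Henstock_Kurzweil_Integration.integral_combine[OF st(1,2) int] by simp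
    moreover have "d s * (t - s) \<le> integral {s..t} d"
      using integral_le[OF integrable_const_ivl[of "d s" s t] int] monoD[OF mono] st
      by (simp add: mult.commute)
    moreover have "integral {s..t} d \<le> d t * (t - s)"
      using integral_le[OF int integrable_const_ivl[of "d t" s t]] monoD[OF mono] st
      by (simp add: mult.commute)
    ultimately show "\<bar>K t - K s\<bar> \<le> (d t - d s) * (t - s)"
      using slope[of s t] slope[of t s] by (simp add: K_def abs_le_iff algebra_simps)
  qed
  then have "integral {a..b} d = h b - h a"
    by (simp add: K_def)
  then show ?thesis
    using int by (metis integrable_integral)
qed

section \<open>A Kantorovich potential for a monotone map\<close>

text \<open>The first order condition for $x \mapsto h(x-y) - \varphi(x)$ to be minimal at each $x$ with
$g(x)=y$ is $\varphi'(x) = h'(x-g(x))$, so $\varphi$ is the integral of $s \mapsto d(s-g(s))$ for a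
supporting slope $d$ of $h$. The two bounds come from the monotonicity of $d$: replacing $g(s)$ by
a smaller $y$ raises $d(s-g(s))$, replacing it by a larger one lowers it.\<close>

lemma transport_potential_exists:
  fixes h g :: "real \<Rightarrow> real"
  assumes h: "convex_on UNIV h" and g: "mono g"
  obtains \<phi> :: "real \<Rightarrow> real" where "\<phi> \<in> borel_measurable borel"
    "\<And>a b y. a \<le> b \<Longrightarrow> y \<le> g a \<Longrightarrow> \<phi> b - \<phi> a \<le> h (b - y) - h (a - y)"
    "\<And>a b y. a \<le> b \<Longrightarrow> g b \<le> y \<Longrightarrow> h (b - y) - h (a - y) \<le> \<phi> b - \<phi> a"
proof -
  obtain d where d: "\<And>x y. h x + d x * (y - x) \<le> h y"
    using supporting_slope_exists[OF h] by blast
  have mono: "mono d"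
    using d by (rule supporting_slope_mono)
  define m where "m s = d (s - g s)" for s
  have [measurable]: "d \<in> borel_measurable borel" "g \<in> borel_measurable borel"
    using mono g by (auto intro: borel_measurable_mono)
  have int: "m integrable_on {a..b}" for a b
  proof (rule bounded_measurable_integrable_on)
    show "m \<in> borel_measurable borel"
      unfolding m_def by measurable
    fix s assume "s \<in> {a..b}"
    then have "a - g b \<le> s - g s" "s - g s \<le> b - g a"
      using monoD[OF g, of s b] monoD[OF g, of a s] by auto
    then show "\<bar>m s\<bar> \<le> \<bar>d (a - g b)\<bar> + \<bar>d (b - g a)\<bar>"
      unfolding m_def using monoD[OF mono, of "a - g b" "s - g s"] monoD[OF mono, of "s - g s" "b - g a"]
      by auto
  qed
  \<comment> \<open>One of the two integrals is over at most one point, so this is the oriented integral from 0.\<close>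
  define \<phi> where "\<phi> x = integral {0..x} m - integral {x..0} m" for x
  have incr: "\<phi> b - \<phi> a = integral {a..b} m" if "a \<le> b" for a b
    using Henstock_Kurzweil_Integration.integral_combine[of 0 a b m]
      Henstock_Kurzweil_Integration.integral_combine[of a 0 b m]
      Henstock_Kurzweil_Integration.integral_combine[of a b 0 m] int that
    by (cases "0 \<le> a"; cases "0 \<le> b"; cases "a = 0"; cases "b = 0") (auto simp: \<phi>_def)
  have slope: "((\<lambda>s. d (s - y)) has_integral (h (b - y) - h (a - y))) {a..b}" if "a \<le> b" for a b y
    using supporting_slope_has_integral[of "\<lambda>s. h (s - y)" "\<lambda>s. d (s - y)" a b] d that
    by (metis diff_diff_eq2 diff_add_cancel)
  show thesis
  proof
    have "isCont \<phi> x" for x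
    proof -
      define N where "N = \<bar>x\<bar> + 1"
      have "continuous_on {-N..N} (\<lambda>x. \<phi> (-N) + integral {-N..x} m)"
        by (intro continuous_intros indefinite_integral_continuous_1 int)
      moreover have "\<phi> (-N) + integral {-N..x} m = \<phi> x" if "x \<in> {-N..N}" for x
        using incr[of "-N" x] that by simp
      ultimately have "continuous_on {-N..N} \<phi>"
        by (rule continuous_on_eq)
      moreover have "x \<in> interior {-N..N}"
        by (auto simp: N_def)
      ultimately show ?thesis
        by (rule continuous_on_interior)
    qed
    then show "\<phi> \<in> borel_measurable borel"
      by (intro borel_measurable_continuous_onI continuous_at_imp_continuous_on) simp
  next
    fix a b y assume "a \<le> b" "y \<le> g a"
    then have "m s \<le> d (s - y)" if "s \<in> {a..b}" for s
      unfolding m_def using that monoD[OF g, of a s] by (intro monoD[OF mono]) auto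
    then show "\<phi> b - \<phi> a \<le> h (b - y) - h (a - y)"
      using has_integral_le[OF integrable_integral[OF int] slope] incr \<open>a \<le> b\<close> by metis
  next
    fix a b y assume "a \<le> b" "g b \<le> y"
    then have "d (s - y) \<le> m s" if "s \<in> {a..b}" for s
      unfolding m_def using that monoD[OF g, of s b] by (intro monoD[OF mono]) auto
    then show "h (b - y) - h (a - y) \<le> \<phi> b - \<phi> a"
      using has_integral_le[OF slope integrable_integral[OF int]] incr \<open>a \<le> b\<close> by metis
  qed
qed

lemma potential_minimal_on_graph:
  fixes h g \<phi> :: "real \<Rightarrow> real"
  assumes "mono g"
    and "\<And>a b y. a \<le> b \<Longrightarrow> y \<le> g a \<Longrightarrow> \<phi> b - \<phi> a \<le> h (b - y) - h (a - y)"
    and "\<And>a b y. a \<le> b \<Longrightarrow> g b \<le> y \<Longrightarrow> h (b - y) - h (a - y) \<le> \<phi> b - \<phi> a"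
  shows "h (x - g x) - \<phi> x \<le> h (u - g x) - \<phi> u"
proof (cases "x \<le> u")
  case True
  then show ?thesis
    using assms(2)[of x u "g x"] by simp
next
  case False
  then show ?thesis
    using assms(3)[of u x "g x"] by simp
qed

text \<open>If, say, $y < g(x)$, then continuity gives $a < x$ with still $y < g(a)$. Moving from $x$ to $a$
changes $\varphi$ by an amount that is controlled with $g(a)$ in place of $y$, and strict convexity
then makes $a$ strictly better than $x$.\<close>

lemma potential_minimal_imp_graph:
  fixes h g \<phi> :: "real \<Rightarrow> real"
  assumes h: "strictly_convex h" and g: "mono g"
    and le: "\<And>a b y. a \<le> b \<Longrightarrow> y \<le> g a \<Longrightarrow> \<phi> b - \<phi> a \<le> h (b - y) - h (a - y)"
    and ge: "\<And>a b y. a \<le> b \<Longrightarrow> g b \<le> y \<Longrightarrow> h (b - y) - h (a - y) \<le> \<phi> b - \<phi> a"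
    and min: "\<And>u. h (x - y) - \<phi> x \<le> h (u - y) - \<phi> u"
    and cont: "isCont g x"
  shows "y = g x"
proof (rule ccontr)
  assume "y \<noteq> g x"
  have left: "(g \<longlongrightarrow> g x) (at_left x)" and right: "(g \<longlongrightarrow> g x) (at_right x)"
    using cont unfolding isCont_def filterlim_at_split by blast+
  from \<open>y \<noteq> g x\<close> consider "y < g x" | "g x < y"
    by linarith
  then show False
  proof cases
    case 1
    then have "\<forall>\<^sub>F a in at_left x. y < g a"
      using order_tendstoD(1)[OF left] by blast
    then have "\<exists>a<x. y < g a"
      by (auto simp: eventually_at_left_field dest: dense)
    then obtain a where a: "a < x" "y < g a"
      by blast
    have "h (x - g a) - h (a - g a) < h (x - y) - h (a - y)"
      using strictly_convex_increment_less[OF h, of "a - g a" "a - y" "x - a"] a by simp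
    then show False
      using le[of a x "g a"] min[of a] a by simp
  next
    case 2
    then have "\<forall>\<^sub>F b in at_right x. g b < y"
      using order_tendstoD(2)[OF right] by blast
    then have "\<exists>b>x. g b < y"
      by (auto simp: eventually_at_right_field dest: dense)
    then obtain b where b: "x < b" "g b < y"
      by blast
    have "h (b - y) - h (x - y) < h (b - g b) - h (x - g b)"
      using strictly_convex_increment_less[OF h, of "x - y" "x - g b" "b - x"] b by simp
    then show False
      using ge[of x b "g b"] min[of b] b by simp
  qed
qed

section \<open>Optimality of monotone couplings\<close>

text \<open>Clamping to $[-n,n]$ is an odd, nondecreasing contraction, and $u+v = u-(-v)$.\<close>

lemma clamp_add_le:
  fixes u v n :: real
  assumes "0 \<le> n"
  shows "\<bar>max (- n) (min n u) + max (- n) (min n v)\<bar> \<le> \<bar>u + v\<bar>"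
    and "max (- n) (min n u) + max (- n) (min n v) \<le> max 0 (u + v)"
  using assms by (auto simp: max_def min_def abs_if)

lemma clamp_tendsto: "(\<lambda>n. max (- real n) (min (real n) u)) \<longlonglongrightarrow> u"
proof (rule tendsto_eventually)
  obtain N where "\<bar>u\<bar> \<le> real N"
    using real_arch_simple by blast
  then show "\<forall>\<^sub>F n in sequentially. max (- real n) (min (real n) u) = u"
    unfolding eventually_sequentially
    by (intro exI[of _ N]) (auto simp: max_def min_def abs_if split: if_splits)
qed

text \<open>If $U$ and $V$ were integrable, $\int (U+V) = \int (U+V') = \int c_0$ would follow at once from the
equality of the laws of $V$ and $V'$. Only the sums are under control, so $U$, $V$ and $V'$ are
clamped first. On the right, clamped sums are dominated by $|c_0|$; on the left they are bounded
above by $c^+$, and Fatou's lemma gives $\int (c - U - V) \le \int c - \int c_0$. The integrand is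
nonnegative, which yields both claims.\<close>

lemma (in finite_measure) dual_pair_optimal:
  fixes U V V' c c\<^sub>0 :: "'a \<Rightarrow> real"
  assumes [measurable]: "U \<in> borel_measurable M" "V \<in> borel_measurable M" "V' \<in> borel_measurable M"
    and law: "distr M borel V = distr M borel V'"
    and c: "integrable M c" and c0: "integrable M c\<^sub>0"
    and le: "AE \<omega> in M. U \<omega> + V \<omega> \<le> c \<omega>"
    and eq: "AE \<omega> in M. U \<omega> + V' \<omega> = c\<^sub>0 \<omega>"
  shows "(\<integral>\<omega>. c\<^sub>0 \<omega> \<partial>M) \<le> (\<integral>\<omega>. c \<omega> \<partial>M)"
    and "(\<integral>\<omega>. c \<omega> \<partial>M) \<le> (\<integral>\<omega>. c\<^sub>0 \<omega> \<partial>M) \<Longrightarrow> AE \<omega> in M. U \<omega> + V \<omega> = c \<omega>"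
proof -
  define T :: "nat \<Rightarrow> real \<Rightarrow> real" where "T n u = max (- real n) (min (real n) u)" for n u
  have [measurable]: "T n \<in> borel_measurable borel" for n
    unfolding T_def by measurable
  have [measurable]: "c \<in> borel_measurable M" "c\<^sub>0 \<in> borel_measurable M"
    using c c0 by auto
  have T_lim: "(\<lambda>n. T n u) \<longlonglongrightarrow> u" for u
    unfolding T_def by (rule clamp_tendsto)
  have T_int: "integrable M (\<lambda>\<omega>. T n (W \<omega>))" if [measurable]: "W \<in> borel_measurable M" for W n
    by (rule integrable_const_bound[where B = "real n"]) (auto simp: T_def)
  define w where "w n \<omega> = T n (U \<omega>) + T n (V \<omega>)" for n \<omega>
  have w_int: "integrable M (w n)" for n
    unfolding w_def by (intro Bochner_Integration.integrable_add T_int) auto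
  have T_law: "(\<integral>\<omega>. T n (V \<omega>) \<partial>M) = (\<integral>\<omega>. T n (V' \<omega>) \<partial>M)" for n
    using integral_distr[of V M borel "T n"] integral_distr[of V' M borel "T n"] law by simp
  have "(\<integral>\<omega>. w n \<omega> \<partial>M) = (\<integral>\<omega>. T n (U \<omega>) + T n (V' \<omega>) \<partial>M)" for n
    unfolding w_def using T_law by (simp add: T_int)
  moreover have "(\<lambda>n. \<integral>\<omega>. T n (U \<omega>) + T n (V' \<omega>) \<partial>M) \<longlonglongrightarrow> (\<integral>\<omega>. c\<^sub>0 \<omega> \<partial>M)"
  proof (rule integral_dominated_convergence[where w = "\<lambda>\<omega>. \<bar>c\<^sub>0 \<omega>\<bar>"])
    show "AE \<omega> in M. (\<lambda>n. T n (U \<omega>) + T n (V' \<omega>)) \<longlonglongrightarrow> c\<^sub>0 \<omega>"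
      using eq by eventually_elim (metis tendsto_add T_lim)
    show "AE \<omega> in M. norm (T n (U \<omega>) + T n (V' \<omega>)) \<le> \<bar>c\<^sub>0 \<omega>\<bar>" for n
      using eq by eventually_elim (metis T_def clamp_add_le(1) of_nat_0_le_iff real_norm_def)
  qed (use c0 in auto)
  ultimately have w_lim: "(\<lambda>n. \<integral>\<omega>. w n \<omega> \<partial>M) \<longlonglongrightarrow> (\<integral>\<omega>. c\<^sub>0 \<omega> \<partial>M)"
    by simp
  define c\<^sub>p where "c\<^sub>p \<omega> = max 0 (c \<omega>)" for \<omega>
  have cp: "integrable M c\<^sub>p"
    unfolding c\<^sub>p_def using c by auto
  have [measurable]: "c\<^sub>p \<in> borel_measurable M" "w n \<in> borel_measurable M" for n
    using cp w_int by auto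
  have w_le: "AE \<omega> in M. w n \<omega> \<le> c\<^sub>p \<omega>" for n
    using le
  proof eventually_elim
    case (elim \<omega>)
    have "w n \<omega> \<le> max 0 (U \<omega> + V \<omega>)"
      unfolding w_def T_def by (rule clamp_add_le(2)) simp
    with elim show ?case
      by (auto simp: c\<^sub>p_def)
  qed
  define f where "f \<omega> = c\<^sub>p \<omega> - (U \<omega> + V \<omega>)" for \<omega>
  have [measurable]: "f \<in> borel_measurable M"
    unfolding f_def by measurable
  have f_nonneg: "AE \<omega> in M. 0 \<le> f \<omega>"
    using le by eventually_elim (auto simp: f_def c\<^sub>p_def)
  have "(\<integral>\<^sup>+\<omega>. ennreal (f \<omega>) \<partial>M) = (\<integral>\<^sup>+\<omega>. liminf (\<lambda>n. ennreal (c\<^sub>p \<omega> - w n \<omega>)) \<partial>M)"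
  proof (rule nn_integral_cong)
    fix \<omega>
    have "(\<lambda>n. ennreal (c\<^sub>p \<omega> - w n \<omega>)) \<longlonglongrightarrow> ennreal (f \<omega>)"
      unfolding f_def w_def by (intro tendsto_ennrealI tendsto_intros T_lim)
    then show "ennreal (f \<omega>) = liminf (\<lambda>n. ennreal (c\<^sub>p \<omega> - w n \<omega>))"
      by (metis lim_imp_Liminf trivial_limit_sequentially)
  qed
  also have "\<dots> \<le> liminf (\<lambda>n. \<integral>\<^sup>+\<omega>. ennreal (c\<^sub>p \<omega> - w n \<omega>) \<partial>M)"
    by (rule nn_integral_liminf) measurable
  also have "\<dots> = ennreal ((\<integral>\<omega>. c\<^sub>p \<omega> \<partial>M) - (\<integral>\<omega>. c\<^sub>0 \<omega> \<partial>M))"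
  proof (rule lim_imp_Liminf)
    have "(\<integral>\<^sup>+\<omega>. ennreal (c\<^sub>p \<omega> - w n \<omega>) \<partial>M) = ennreal ((\<integral>\<omega>. c\<^sub>p \<omega> \<partial>M) - (\<integral>\<omega>. w n \<omega> \<partial>M))" for n
      using nn_integral_eq_integral[of M "\<lambda>\<omega>. c\<^sub>p \<omega> - w n \<omega>"] w_le[of n] cp w_int by simp
    then show "(\<lambda>n. \<integral>\<^sup>+\<omega>. ennreal (c\<^sub>p \<omega> - w n \<omega>) \<partial>M) \<longlonglongrightarrow> ennreal ((\<integral>\<omega>. c\<^sub>p \<omega> \<partial>M) - (\<integral>\<omega>. c\<^sub>0 \<omega> \<partial>M))"
      by (simp only:) (intro tendsto_ennrealI tendsto_intros w_lim)
  qed simp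
  finally have bound: "(\<integral>\<^sup>+\<omega>. ennreal (f \<omega>) \<partial>M) \<le> ennreal ((\<integral>\<omega>. c\<^sub>p \<omega> \<partial>M) - (\<integral>\<omega>. c\<^sub>0 \<omega> \<partial>M))" .
  have f_int: "integrable M f"
    using bound f_nonneg by (intro integrableI_nonneg) (auto intro: le_less_trans)
  have cp_ge: "0 \<le> (\<integral>\<omega>. c\<^sub>p \<omega> \<partial>M) - (\<integral>\<omega>. c\<^sub>0 \<omega> \<partial>M)"
  proof (rule LIMSEQ_le_const)
    show "(\<lambda>n. (\<integral>\<omega>. c\<^sub>p \<omega> \<partial>M) - (\<integral>\<omega>. w n \<omega> \<partial>M)) \<longlonglongrightarrow> (\<integral>\<omega>. c\<^sub>p \<omega> \<partial>M) - (\<integral>\<omega>. c\<^sub>0 \<omega> \<partial>M)"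
      by (intro tendsto_intros w_lim)
    show "\<exists>N. \<forall>n\<ge>N. 0 \<le> (\<integral>\<omega>. c\<^sub>p \<omega> \<partial>M) - (\<integral>\<omega>. w n \<omega> \<partial>M)"
      using integral_mono_AE[OF w_int cp w_le] by simp
  qed
  have f_le: "(\<integral>\<omega>. f \<omega> \<partial>M) \<le> (\<integral>\<omega>. c\<^sub>p \<omega> \<partial>M) - (\<integral>\<omega>. c\<^sub>0 \<omega> \<partial>M)"
    using bound cp_ge nn_integral_eq_integral[OF f_int f_nonneg] by (simp add: ennreal_le_iff)
  define r where "r \<omega> = f \<omega> - c\<^sub>p \<omega> + c \<omega>" for \<omega>
  have r: "r \<omega> = c \<omega> - (U \<omega> + V \<omega>)" for \<omega>
    by (simp add: r_def f_def)
  have r_int: "integrable M r"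
    unfolding r_def using f_int cp c by auto
  have r_nonneg: "AE \<omega> in M. 0 \<le> r \<omega>"
    using le by (simp add: r)
  have "(\<integral>\<omega>. r \<omega> \<partial>M) = (\<integral>\<omega>. f \<omega> \<partial>M) - (\<integral>\<omega>. c\<^sub>p \<omega> \<partial>M) + (\<integral>\<omega>. c \<omega> \<partial>M)"
    unfolding r_def using f_int cp c by simp
  then have r_le: "(\<integral>\<omega>. r \<omega> \<partial>M) \<le> (\<integral>\<omega>. c \<omega> \<partial>M) - (\<integral>\<omega>. c\<^sub>0 \<omega> \<partial>M)"
    using f_le by simp
  have r_ge: "0 \<le> (\<integral>\<omega>. r \<omega> \<partial>M)"
    using r_nonneg by (rule integral_nonneg_AE)
  show "(\<integral>\<omega>. c\<^sub>0 \<omega> \<partial>M) \<le> (\<integral>\<omega>. c \<omega> \<partial>M)"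
    using r_le r_ge by simp
  assume "(\<integral>\<omega>. c \<omega> \<partial>M) \<le> (\<integral>\<omega>. c\<^sub>0 \<omega> \<partial>M)"
  then have "(\<integral>\<omega>. r \<omega> \<partial>M) = 0"
    using r_le r_ge by simp
  then have "AE \<omega> in M. r \<omega> = 0"
    using integral_nonneg_eq_0_iff_AE[OF r_int r_nonneg] by simp
  then show "AE \<omega> in M. U \<omega> + V \<omega> = c \<omega>"
    by eventually_elim (simp add: r)
qed

lemma (in prob_space) AE_notin_countable:
  fixes X :: "'a \<Rightarrow> 'b::t1_space"
  assumes [measurable]: "X \<in> borel_measurable M"
    and atomless: "\<And>x. measure (distr M borel X) {x} = 0" and "countable A"
  shows "AE \<omega> in M. X \<omega> \<notin> A"
proof -
  have "AE \<omega> in M. X \<omega> \<noteq> x" for x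
  proof -
    have "prob (X -` {x} \<inter> space M) = 0"
      using atomless[of x] by (simp add: measure_distr)
    then have "AE \<omega> in M. \<omega> \<notin> X -` {x} \<inter> space M"
      by (subst (asm) prob_eq_0) measurable
    with AE_space show ?thesis
      by eventually_elim auto
  qed
  then have "AE \<omega> in M. \<forall>x\<in>A. X \<omega> \<noteq> x"
    using \<open>countable A\<close> by (simp add: AE_ball_countable)
  then show ?thesis
    by eventually_elim auto
qed

text \<open>Kantorovich duality with explicit potentials: $\varphi$ as constructed for $g$ and its
$c$-transform $\psi(y) = \inf_x (h(x-y)-\varphi(x))$. Their sum is below the cost everywhere and
equal to it on the graph of $g$. In the case of equality, $X$ minimises $u \mapsto h(u-Y)-\varphi(u)$
almost surely; off the countably many discontinuities of $g$, which the atomless law of $X$ does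
not see, this forces $Y = g(X)$.\<close>

theorem (in prob_space) monotone_coupling_optimal:
  fixes X Y :: "'a \<Rightarrow> real" and g h :: "real \<Rightarrow> real"
  assumes X[measurable]: "X \<in> borel_measurable M" and Y[measurable]: "Y \<in> borel_measurable M"
    and g: "mono g" and h: "strictly_convex h"
    and atomless: "\<And>x. measure (distr M borel X) {x} = 0"
    and law: "distr M borel Y = distr M borel (\<lambda>\<omega>. g (X \<omega>))"
    and int: "integrable M (\<lambda>\<omega>. h (X \<omega> - Y \<omega>))" and int_g: "integrable M (\<lambda>\<omega>. h (X \<omega> - g (X \<omega>)))"
  shows "(\<integral>\<omega>. h (X \<omega> - g (X \<omega>)) \<partial>M) \<le> (\<integral>\<omega>. h (X \<omega> - Y \<omega>) \<partial>M)"
    and "(\<integral>\<omega>. h (X \<omega> - Y \<omega>) \<partial>M) \<le> (\<integral>\<omega>. h (X \<omega> - g (X \<omega>)) \<partial>M) \<Longrightarrow> AE \<omega> in M. Y \<omega> = g (X \<omega>)"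
proof -
  have convex: "convex_on UNIV h"
    using h by (rule strictly_convex_imp_convex_on)
  then have h_cont: "continuous_on UNIV h"
    by (intro convex_on_continuous) auto
  have [measurable]: "g \<in> borel_measurable borel"
    using g by (rule borel_measurable_mono)
  obtain \<phi> where \<phi>[measurable]: "\<phi> \<in> borel_measurable borel"
    and \<phi>_le: "\<And>a b y. a \<le> b \<Longrightarrow> y \<le> g a \<Longrightarrow> \<phi> b - \<phi> a \<le> h (b - y) - h (a - y)"
    and \<phi>_ge: "\<And>a b y. a \<le> b \<Longrightarrow> g b \<le> y \<Longrightarrow> h (b - y) - h (a - y) \<le> \<phi> b - \<phi> a"
    using transport_potential_exists[OF convex g] by blast
  \<comment> \<open>Extended values, because the infimum can be \<open>-\<infinity>\<close> for \<open>y\<close> outside the range of \<open>g\<close>.\<close>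
  define \<psi> where "\<psi> y = (INF x. ereal (h (x - y) - \<phi> x))" for y
  have [measurable]: "\<psi> \<in> borel_measurable borel"
  proof (rule borel_measurableI_ge)
    fix z
    have "continuous_on UNIV (\<lambda>y. ereal (h (x - y) - \<phi> x))" for x
      by (intro continuous_intros continuous_on_compose2[OF h_cont]) auto
    then have "closed {y. \<forall>x. z \<le> ereal (h (x - y) - \<phi> x)}"
      by (intro closed_Collect_all closed_Collect_le continuous_on_const)
    then show "{y \<in> space borel. z \<le> \<psi> y} \<in> sets borel"
      by (simp add: \<psi>_def le_INF_iff)
  qed
  have \<psi>_le: "\<psi> y \<le> ereal (h (x - y) - \<phi> x)" for x y
    unfolding \<psi>_def by (rule INF_lower) simp
  have \<psi>_graph: "\<psi> (g x) = ereal (h (x - g x) - \<phi> x)" for x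
  proof (rule antisym[OF \<psi>_le])
    show "ereal (h (x - g x) - \<phi> x) \<le> \<psi> (g x)"
      unfolding \<psi>_def using potential_minimal_on_graph[where h = h and g = g and \<phi> = \<phi>, OF g \<phi>_le \<phi>_ge] by (intro INF_greatest) simp
  qed
  have "AE y in distr M borel (\<lambda>\<omega>. g (X \<omega>)). \<psi> y \<noteq> -\<infinity>"
    by (subst AE_distr_iff) (auto simp: \<psi>_graph)
  then have "AE y in distr M borel Y. \<psi> y \<noteq> -\<infinity>"
    unfolding law .
  then have "AE \<omega> in M. \<psi> (Y \<omega>) \<noteq> -\<infinity>"
    by (subst (asm) AE_distr_iff) auto
  then have \<psi>_finite: "AE \<omega> in M. \<psi> (Y \<omega>) = ereal (real_of_ereal (\<psi> (Y \<omega>)))"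
  proof eventually_elim
    case (elim \<omega>)
    then show ?case
      using \<psi>_le[of "Y \<omega>" 0] by (cases "\<psi> (Y \<omega>)") auto
  qed
  have law_\<psi>: "distr M borel (\<lambda>\<omega>. real_of_ereal (\<psi> (Y \<omega>))) = distr M borel (\<lambda>\<omega>. real_of_ereal (\<psi> (g (X \<omega>))))"
    using arg_cong[OF law, of "\<lambda>N. distr N borel (\<lambda>y. real_of_ereal (\<psi> y))"]
    by (subst (asm) (1 2) distr_distr) (auto simp: comp_def)
  have le: "AE \<omega> in M. \<phi> (X \<omega>) + real_of_ereal (\<psi> (Y \<omega>)) \<le> h (X \<omega> - Y \<omega>)"
    using \<psi>_finite
  proof eventually_elim
    case (elim \<omega>)
    then have "ereal (real_of_ereal (\<psi> (Y \<omega>))) \<le> ereal (h (X \<omega> - Y \<omega>) - \<phi> (X \<omega>))"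
      using \<psi>_le[of "Y \<omega>" "X \<omega>"] by metis
    then show ?case
      by simp
  qed
  have eq: "AE \<omega> in M. \<phi> (X \<omega>) + real_of_ereal (\<psi> (g (X \<omega>))) = h (X \<omega> - g (X \<omega>))"
    by (simp add: \<psi>_graph)
  note dual = dual_pair_optimal[OF _ _ _ law_\<psi> int int_g le eq]
  show "(\<integral>\<omega>. h (X \<omega> - g (X \<omega>)) \<partial>M) \<le> (\<integral>\<omega>. h (X \<omega> - Y \<omega>) \<partial>M)"
    by (rule dual(1)) measurable
  assume "(\<integral>\<omega>. h (X \<omega> - Y \<omega>) \<partial>M) \<le> (\<integral>\<omega>. h (X \<omega> - g (X \<omega>)) \<partial>M)"
  then have "AE \<omega> in M. \<phi> (X \<omega>) + real_of_ereal (\<psi> (Y \<omega>)) = h (X \<omega> - Y \<omega>)"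
    by (intro dual(2)) measurable
  moreover have "AE \<omega> in M. X \<omega> \<notin> {x. \<not> isCont g x}"
    using mono_ctble_discont[OF g] by (intro AE_notin_countable atomless X)
  ultimately show "AE \<omega> in M. Y \<omega> = g (X \<omega>)"
    using \<psi>_finite
  proof eventually_elim
    case (elim \<omega>)
    have "ereal (h (X \<omega> - Y \<omega>) - \<phi> (X \<omega>)) \<le> ereal (h (u - Y \<omega>) - \<phi> u)" for u
      using elim(1,3) \<psi>_le[of "Y \<omega>" u] by (metis add_diff_cancel_left')
    then show ?case
      using elim(2) by (intro potential_minimal_imp_graph[where h = h and g = g and \<phi> = \<phi>, OF h g \<phi>_le \<phi>_ge]) auto
  qed
qed

section \<open>Monotone rearrangement\<close>

text \<open>The distribution function of an atomless law, evaluated at a variable with that law, is uniformly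
distributed on $[0,1]$: the set is a half line $(-\infty,a]$, and $F(a)=c$ by continuity.\<close>

lemma (in real_distribution) continuous_cdf_uniform:
  assumes atomless: "\<And>x. measure M {x} = 0" and "0 \<le> c" "c \<le> 1"
  shows "measure M {x. cdf M x \<le> c} = c"
proof (cases "c = 1 \<or> {x. cdf M x \<le> c} = {}")
  case True
  have "c = 0" if "{x. cdf M x \<le> c} = {}"
  proof -
    have "c \<le> cdf M x" for x
      using that by (auto simp: not_le dest: less_imp_le)
    then have "c \<le> 0"
      using cdf_lim_at_bot by (intro tendsto_lowerbound[OF _ always_eventually]) auto
    with \<open>0 \<le> c\<close> show ?thesis
      by simp
  qed
  moreover have "{x. cdf M x \<le> 1} = UNIV"
    using cdf_bounded_prob by auto
  ultimately show ?thesis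
    using True prob_space by auto
next
  case False
  define A where "A = {x. cdf M x \<le> c}"
  have cont: "isCont (cdf M) x" for x
    using atomless by (simp add: isCont_cdf)
  then have "closed A"
    unfolding A_def by (intro closed_Collect_le continuous_at_imp_continuous_on continuous_on_const) auto
  have "\<forall>\<^sub>F x in at_top. c < cdf M x"
    using cdf_lim_at_top_prob False \<open>c \<le> 1\<close> by (intro order_tendstoD(1)) auto
  then obtain b where b: "c < cdf M b"
    by (metis eventually_happens trivial_limit_at_top_linorder)
  have "x \<le> b" if "x \<in> A" for x
    using that b cdf_nondecreasing[of b x] by (force simp: A_def not_le)
  then have bdd: "bdd_above A"
    by (rule bdd_aboveI)
  define a where "a = Sup A"
  have "a \<in> A"
    unfolding a_def using closed_contains_Sup[OF _ bdd \<open>closed A\<close>] False by (simp add: A_def)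
  moreover have "c \<le> cdf M a"
  proof (rule ccontr)
    assume "\<not> c \<le> cdf M a"
    then have "\<forall>\<^sub>F x in at_right a. cdf M x < c"
      using cdf_is_right_cont[of a] by (intro order_tendstoD(2)) (auto simp: continuous_within)
    then obtain x where "a < x" "cdf M x < c"
      by (auto simp: eventually_at_right_field dest: dense)
    then show False
      using cSup_upper[OF _ bdd, of x] by (simp add: A_def a_def)
  qed
  ultimately have "cdf M a = c"
    by (simp add: A_def)
  moreover have "A = {..a}"
    using cSup_upper[OF _ bdd] cdf_nondecreasing[of _ a] \<open>a \<in> A\<close>
    by (force simp: A_def a_def)
  ultimately show ?thesis
    by (simp add: cdf_def A_def)
qed

text \<open>The map is $g = G^{-1} \circ F$ with the generalised inverse of the distribution function of $Y$. As
$0 \le Y \le X$, the distribution functions satisfy $F \le G$, so $\max(0,x)$ always belongs to the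
set $L(x)$ whose infimum defines $g(x)$. This makes $g$ finite everywhere and gives
$g(x) \le x$ for $x \ge 0$.\<close>

theorem (in prob_space) monotone_rearrangement_exists:
  fixes X Y :: "'a \<Rightarrow> real"
  assumes X[measurable]: "X \<in> borel_measurable M" and Y[measurable]: "Y \<in> borel_measurable M"
    and atomless: "\<And>x. measure (distr M borel X) {x} = 0"
    and Y_nonneg: "AE \<omega> in M. 0 \<le> Y \<omega>" and Y_le: "AE \<omega> in M. Y \<omega> \<le> X \<omega>"
  obtains g where "mono g" "\<And>x. 0 \<le> g x" "\<And>x. 0 \<le> x \<Longrightarrow> g x \<le> x"
    "distr M borel (\<lambda>\<omega>. g (X \<omega>)) = distr M borel Y"
proof -
  interpret A: real_distribution "distr M borel X"
    by (rule real_distribution_distr) simp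
  interpret B: real_distribution "distr M borel Y"
    by (rule real_distribution_distr) simp
  define F where "F = cdf (distr M borel X)"
  define G where "G = cdf (distr M borel Y)"
  have F_le_G: "F x \<le> G x" for x
    unfolding F_def G_def cdf_def using Y_le
    by (auto simp: measure_distr intro!: finite_measure_mono_AE)
  define L where "L x = {y. 0 \<le> y \<and> F x \<le> G y}" for x
  define g where "g x = Inf (L x)" for x
  have L_self: "x \<in> L x" if "0 \<le> x" for x
    using that F_le_G by (simp add: L_def)
  have L_mono: "L x' \<subseteq> L x" if "x \<le> x'" for x x'
    using A.cdf_nondecreasing[OF that] by (auto simp: L_def F_def)
  have L_ne: "L x \<noteq> {}" for x
    using L_self[of "max 0 x"] L_mono[of x "max 0 x"] by auto
  have bdd: "bdd_below (L x)" for x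
    by (rule bdd_belowI[of _ 0]) (simp add: L_def)
  have g_mono: "mono g"
    unfolding g_def by (intro monoI cInf_superset_mono L_ne bdd L_mono)
  then have [measurable]: "g \<in> borel_measurable borel"
    by (rule borel_measurable_mono)
  have g_nonneg: "0 \<le> g x" for x
    unfolding g_def by (intro cInf_greatest L_ne) (simp add: L_def)
  \<comment> \<open>The infimum is attained because \<open>G\<close> is continuous from the right.\<close>
  have galois: "g x \<le> y \<longleftrightarrow> F x \<le> G y" if "0 \<le> y" for x y
  proof
    assume "F x \<le> G y"
    then show "g x \<le> y"
      unfolding g_def using that by (intro cInf_lower bdd) (simp add: L_def)
  next
    assume "g x \<le> y"
    show "F x \<le> G y"
    proof (rule tendsto_lowerbound)
      show "(G \<longlongrightarrow> G y) (at_right y)"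
        using B.cdf_is_right_cont[of y] by (simp add: G_def continuous_within)
      have "F x \<le> G z" if "y < z" for z
      proof -
        have "Inf (L x) < z"
          using that \<open>g x \<le> y\<close> by (simp add: g_def)
        then obtain y' where "y' \<in> L x" "y' < z"
          using cInf_lessD[OF L_ne] by blast
        then show ?thesis
          using B.cdf_nondecreasing[of y' z] by (simp add: L_def G_def)
      qed
      then show "\<forall>\<^sub>F z in at_right y. F x \<le> G z"
        by (simp add: eventually_at_filter)
    qed simp
  qed
  have "cdf (distr M borel (\<lambda>\<omega>. g (X \<omega>))) y = G y" for y
  proof (cases "0 \<le> y")
    case True
    have "cdf (distr M borel (\<lambda>\<omega>. g (X \<omega>))) y = measure (distr M borel X) {x. F x \<le> G y}"
      using True by (subst measure_distr) (auto simp: cdf_def measure_distr galois[symmetric] vimage_def)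
    also have "\<dots> = G y"
      unfolding F_def G_def using atomless B.cdf_bounded_prob
      by (intro A.continuous_cdf_uniform) (auto simp: cdf_def)
    finally show ?thesis .
  next
    case False
    have "prob (Y -` {..y} \<inter> space M) = 0"
      using Y_nonneg False by (subst prob_eq_0) auto
    moreover have "(\<lambda>\<omega>. g (X \<omega>)) -` {..y} \<inter> space M = {}"
      using g_nonneg False by (auto intro: order_trans)
    ultimately show ?thesis
      by (simp add: cdf_def G_def measure_distr)
  qed
  then have "distr M borel (\<lambda>\<omega>. g (X \<omega>)) = distr M borel Y"
    by (intro cdf_unique) (auto simp: G_def)
  moreover have "g x \<le> x" if "0 \<le> x" for x
    using galois[OF that] F_le_G by simp
  ultimately show thesis
    using that g_mono g_nonneg by blast
qed

section \<open>Treaties, mixtures and the first order condition\<close>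

lemma closed_AR: "closed (AR :: ((real ^ 'n) \<times> (real ^ 'n)) set)"
proof -
  have "closed {z :: (real ^ 'n) \<times> (real ^ 'n). \<forall>i. 0 \<le> snd z $ i \<and> snd z $ i \<le> fst z $ i}"
    by (intro closed_Collect_all closed_Collect_conj closed_Collect_le continuous_intros)
  also have "{z. \<forall>i. 0 \<le> snd z $ i \<and> snd z $ i \<le> fst z $ i} = AR"
    by (auto simp: AR_def)
  finally show ?thesis .
qed

lemma AR_sets [measurable]: "AR \<in> sets borel"
  using closed_AR by (rule borel_closed)

lemma fst_snd_borel [measurable]:
  "(fst :: (real ^ 'n) \<times> (real ^ 'n) \<Rightarrow> _) \<in> borel_measurable borel"
  "(snd :: (real ^ 'n) \<times> (real ^ 'n) \<Rightarrow> _) \<in> borel_measurable borel"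
  by (auto intro!: borel_measurable_continuous_onI continuous_intros)

lemma vec_borel [measurable]:
  "(vec :: real \<Rightarrow> real ^ 'n) \<in> borel_measurable borel"
  "(\<lambda>x :: real ^ 'n. x $ i) \<in> borel_measurable borel"
  by (auto simp: vec_def intro!: borel_measurable_continuous_onI continuous_intros continuous_on_vec_lambda)

lemma treaty_AE_AR:
  assumes "\<eta> \<in> treaties \<mu>"
  shows "AE z in \<eta>. z \<in> AR"
  using assms prob_space.AE_prob_1[of \<eta> AR] by (simp add: treaties_def)

lemma mixture_treaty:
  assumes \<eta>: "\<eta> \<in> treaties \<mu>" and \<theta>: "\<theta> \<in> treaties \<mu>" and t: "0 \<le> t" "t \<le> 1"
  shows "mixture t \<eta> \<theta> \<in> treaties \<mu>"
proof -
  interpret \<eta>: prob_space \<eta>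
    using \<eta> by (simp add: treaties_def)
  interpret \<theta>: prob_space \<theta>
    using \<theta> by (simp add: treaties_def)
  have sets: "sets \<eta> = sets borel" "sets \<theta> = sets borel" and
    fst: "distr \<eta> borel fst = \<mu>" "distr \<theta> borel fst = \<mu>" and
    AR: "measure \<eta> AR = 1" "measure \<theta> AR = 1"
    using \<eta> \<theta> by (simp_all add: treaties_def)
  note [measurable_cong] = sets
  let ?m = "mixture t \<eta> \<theta>"
  have [measurable_cong]: "sets ?m = sets borel"
    by (simp add: sets)
  have weights: "ennreal (1 - t) * a + ennreal t * a = a" for a
    using t by (simp add: distrib_right[symmetric] ennreal_plus[symmetric] del: ennreal_plus)
  have em: "emeasure ?m A = ennreal (1 - t) * emeasure \<eta> A + ennreal t * emeasure \<theta> A" if "A \<in> sets borel" for A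
    using that by (intro emeasure_mixture) (simp_all add: sets)
  have space: "space ?m = UNIV" "space \<eta> = UNIV" "space \<theta> = UNIV"
    using sets by (simp_all add: sets_eq_imp_space_eq[of _ borel])
  interpret m: prob_space ?m
    using em[of UNIV] weights[of 1] \<eta>.emeasure_space_1 \<theta>.emeasure_space_1
    by (intro prob_spaceI) (simp add: space)
  have "distr ?m borel fst = \<mu>"
  proof (rule measure_eqI)
    show "sets (distr ?m borel fst) = sets \<mu>"
      using fst(1) by (metis sets_distr)
    fix A assume "A \<in> sets (distr ?m borel fst)"
    then have A[measurable]: "A \<in> sets borel"
      by simp
    have "emeasure (distr ?m borel fst) A = emeasure ?m (fst -` A)"
      by (simp add: emeasure_distr space)
    also have "\<dots> = ennreal (1 - t) * emeasure (distr \<eta> borel fst) A + ennreal t * emeasure (distr \<theta> borel fst) A"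
      using measurable_sets[OF fst_snd_borel(1) A] by (simp add: emeasure_distr space em)
    also have "\<dots> = emeasure \<mu> A"
      by (simp add: fst weights)
    finally show "emeasure (distr ?m borel fst) A = emeasure \<mu> A" .
  qed
  moreover have "emeasure ?m AR = 1"
    using em[OF AR_sets] weights[of 1] AR
    by (simp add: \<eta>.emeasure_eq_measure \<theta>.emeasure_eq_measure)
  then have "measure ?m AR = 1"
    by (simp add: measure_def)
  ultimately show ?thesis
    using m.prob_space_axioms by (simp add: treaties_def sets)
qed

text \<open>Difference quotients add because the perturbed measures $\eta + t(\vartheta-\eta)$ with $0<t<1$ are
mixtures and so stay in the class on which $F = F_1 + F_2$ holds.\<close>

lemma assumption_A2_add:
  assumes prob: "\<And>\<eta>. \<eta> \<in> \<M> \<Longrightarrow> prob_space \<eta>"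
    and mix: "\<And>\<eta> \<theta> t. \<eta> \<in> \<M> \<Longrightarrow> \<theta> \<in> \<M> \<Longrightarrow> 0 \<le> t \<Longrightarrow> t \<le> 1 \<Longrightarrow> mixture t \<eta> \<theta> \<in> \<M>"
    and "S \<subseteq> \<M>" and F: "\<And>\<eta>. \<eta> \<in> \<M> \<Longrightarrow> F \<eta> = F1 \<eta> + F2 \<eta>"
    and A2: "assumption_A2_with S F1 p1" "assumption_A2_with S F2 p2"
  shows "assumption_A2_with S F (\<lambda>\<eta> z. p1 \<eta> z + p2 \<eta> z)"
  unfolding assumption_A2_with_def
proof (intro ballI conjI)
  fix \<eta> assume \<eta>: "\<eta> \<in> S"
  show "(\<lambda>z. p1 \<eta> z + p2 \<eta> z) \<in> borel_measurable borel"
    using A2 \<eta> by (intro borel_measurable_add) (auto simp: assumption_A2_with_def)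
  fix \<theta> assume \<theta>: "\<theta> \<in> S"
  have int: "integrable \<eta> (p1 \<eta>)" "integrable \<eta> (p2 \<eta>)" "integrable \<theta> (p1 \<eta>)" "integrable \<theta> (p2 \<eta>)"
    using A2 \<eta> \<theta> by (auto simp: assumption_A2_with_def)
  then show "integrable \<theta> (\<lambda>z. p1 \<eta> z + p2 \<eta> z)"
    by simp
  let ?h = "signed_diff \<theta> \<eta>"
  have \<M>: "\<eta> \<in> \<M>" "\<theta> \<in> \<M>"
    using \<eta> \<theta> \<open>S \<subseteq> \<M>\<close> by auto
  have pert: "F (perturb \<eta> t ?h) = F1 (perturb \<eta> t ?h) + F2 (perturb \<eta> t ?h)" if "0 < t" "t < 1" for t
    using that \<M> by (simp add: perturb_signed_diff prob F mix)
  have "\<forall>\<^sub>F t in at_right 0. (F1 (perturb \<eta> t ?h) - F1 \<eta>) / t + (F2 (perturb \<eta> t ?h) - F2 \<eta>) / t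
      = (F (perturb \<eta> t ?h) - F \<eta>) / t"
    unfolding eventually_at_right_field
    by (rule exI[of _ 1]) (use pert \<M> F in \<open>auto simp: diff_divide_distrib add_divide_distrib\<close>)
  moreover have "((\<lambda>t. (F1 (perturb \<eta> t ?h) - F1 \<eta>) / t + (F2 (perturb \<eta> t ?h) - F2 \<eta>) / t) \<longlongrightarrow>
      ((\<integral>z. p1 \<eta> z \<partial>\<theta>) - (\<integral>z. p1 \<eta> z \<partial>\<eta>)) + ((\<integral>z. p2 \<eta> z \<partial>\<theta>) - (\<integral>z. p2 \<eta> z \<partial>\<eta>))) (at_right 0)"
    using A2 \<eta> \<theta> by (intro tendsto_add) (auto simp: assumption_A2_with_def has_directional_derivative_def)
  ultimately have "((\<lambda>t. (F (perturb \<eta> t ?h) - F \<eta>) / t) \<longlongrightarrow>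
      ((\<integral>z. p1 \<eta> z \<partial>\<theta>) - (\<integral>z. p1 \<eta> z \<partial>\<eta>)) + ((\<integral>z. p2 \<eta> z \<partial>\<theta>) - (\<integral>z. p2 \<eta> z \<partial>\<eta>))) (at_right 0)"
    by (rule Lim_transform_eventually[rotated])
  then show "has_directional_derivative F
      ((\<integral>z. p1 \<eta> z + p2 \<eta> z \<partial>\<theta>) - (\<integral>z. p1 \<eta> z + p2 \<eta> z \<partial>\<eta>)) \<eta> ?h"
    unfolding has_directional_derivative_def using int by (simp add: algebra_simps)
qed

text \<open>An optimal treaty is also optimal for its own linearised cost: the difference quotient of $F$ in
the direction of $\vartheta$ is nonnegative by (A1), hence so is its limit.\<close>

lemma optimal_first_order_condition:
  assumes prob: "\<And>\<eta>. \<eta> \<in> S \<Longrightarrow> prob_space \<eta>"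
    and A1: "assumption_A1 S F" and A2: "assumption_A2_with S F p"
    and opt: "optimal_treaty F S \<eta>'" and \<theta>: "\<theta> \<in> S"
  shows "(\<integral>z. p \<eta>' z \<partial>\<eta>') \<le> (\<integral>z. p \<eta>' z \<partial>\<theta>)"
proof -
  have \<eta>': "\<eta>' \<in> S"
    using opt by (simp add: optimal_treaty_def)
  have "0 \<le> (\<integral>z. p \<eta>' z \<partial>\<theta>) - (\<integral>z. p \<eta>' z \<partial>\<eta>')"
  proof (rule tendsto_lowerbound)
    show "((\<lambda>t. (F (perturb \<eta>' t (signed_diff \<theta> \<eta>')) - F \<eta>') / t) \<longlongrightarrow>
        (\<integral>z. p \<eta>' z \<partial>\<theta>) - (\<integral>z. p \<eta>' z \<partial>\<eta>')) (at_right 0)"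
      using A2 \<eta>' \<theta> by (auto simp: assumption_A2_with_def has_directional_derivative_def)
    have "F \<eta>' \<le> F (perturb \<eta>' t (signed_diff \<theta> \<eta>'))" if "0 < t" "t < 1" for t
      using A1 opt \<theta> \<eta>' that by (simp add: perturb_signed_diff prob assumption_A1_def)
    then show "\<forall>\<^sub>F t in at_right 0. 0 \<le> (F (perturb \<eta>' t (signed_diff \<theta> \<eta>')) - F \<eta>') / t"
      unfolding eventually_at_right_field by (intro exI[of _ 1]) auto
  qed simp
  then show ?thesis
    by simp
qed

lemma ereal_integral_cong_AE:
  assumes "AE z in M. f z = g z"
  shows "ereal_integral M f = ereal_integral M g"
proof -
  have "(\<integral>\<^sup>+ z. e2ennreal (f z) \<partial>M) = (\<integral>\<^sup>+ z. e2ennreal (g z) \<partial>M)"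
    "(\<integral>\<^sup>+ z. e2ennreal (- f z) \<partial>M) = (\<integral>\<^sup>+ z. e2ennreal (- g z) \<partial>M)"
    using assms by (auto intro!: nn_integral_cong_AE elim: eventually_mono)
  then show ?thesis
    by (simp add: ereal_integral_def)
qed

lemma treaty_constrained_cost:
  assumes "\<eta> \<in> treaties \<mu>" "integrable \<eta> p"
  shows "ereal_integral \<eta> (constrained_cost p) = ereal (\<integral>z. p z \<partial>\<eta>)"
proof -
  have "ereal_integral \<eta> (constrained_cost p) = ereal_integral \<eta> (\<lambda>z. ereal (p z))"
    using treaty_AE_AR[OF assms(1)]
    by (intro ereal_integral_cong_AE) (auto simp: constrained_cost_def elim: eventually_mono)
  with assms(2) show ?thesis
    by (simp add: ereal_integral_eq_integral)
qed

lemma eq_graph_measure: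
  fixes \<eta> :: "((real ^ 'n) \<times> (real ^ 'n)) measure"
  assumes sets: "sets \<eta> = sets borel" and fst: "distr \<eta> borel fst = \<mu>"
    and f[measurable]: "f \<in> borel_measurable borel" and graph: "AE z in \<eta>. snd z = f (fst z)"
  shows "\<eta> = distr \<mu> borel (\<lambda>x. (x, f x))"
proof -
  note [measurable_cong] = sets
  have "\<eta> = distr \<eta> borel (\<lambda>z. z)"
    using sets by (simp add: distr_id2)
  also have "\<dots> = distr \<eta> borel (\<lambda>z. (fst z, f (fst z)))"
    using graph by (intro distr_cong_AE) (auto simp: prod_eq_iff elim: eventually_mono)
  also have "\<dots> = distr \<mu> borel (\<lambda>x. (x, f x))"
    unfolding fst[symmetric] by (subst distr_distr) (auto simp: comp_def)
  finally show ?thesis .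
qed

section \<open>One risk\<close>

lemma vec_unique_component:
  fixes x :: "'a ^ 'n" and i :: 'n
  assumes "\<And>j. j = i"
  shows "x = vec (x $ i)"
  using assms by (metis vec_eq_iff vec_component)

lemma distr_component_atomless:
  fixes \<mu> :: "(real ^ 'n) measure" and i :: 'n
  assumes i: "\<And>j. j = i" and sets: "sets \<mu> = sets borel" and atomless: "\<And>x. measure \<mu> {x} = 0"
  shows "measure (distr \<mu> borel (\<lambda>x. x $ i)) {r} = 0"
proof -
  note [measurable_cong] = sets
  have "(\<lambda>x. x $ i) -` {r} = {vec r :: real ^ 'n}"
    using vec_unique_component[OF i] by auto
  then show ?thesis
    using atomless by (simp add: measure_distr sets_eq_imp_space_eq[OF sets])
qed

text \<open>Almost surely $0 \le y \le x$ under a treaty, so its ceded marginal is dominated by $\mu$ and the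
monotone rearrangement of $\mu$ into that marginal stays inside the constraint set.\<close>

lemma monotone_treaty_exists:
  fixes \<eta> :: "((real ^ 'n) \<times> (real ^ 'n)) measure" and i :: 'n
  assumes i: "\<And>j. j = i" and \<eta>: "\<eta> \<in> treaties \<mu>" and atomless: "\<And>x. measure \<mu> {x} = 0"
  obtains g where "mono g"
    "distr \<mu> borel (\<lambda>x. (x, vec (g (x $ i)))) \<in> couplings \<mu> (distr \<eta> borel snd) \<inter> treaties \<mu>"
proof -
  note vec = vec_unique_component[OF i]
  interpret \<eta>: prob_space \<eta>
    using \<eta> by (simp add: treaties_def)
  have sets[measurable_cong]: "sets \<eta> = sets borel" and fst: "distr \<eta> borel fst = \<mu>"
    using \<eta> by (simp_all add: treaties_def)
  have sets_\<mu>[measurable_cong]: "sets \<mu> = sets borel"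
    using fst by (metis sets_distr)
  interpret \<mu>: prob_space \<mu>
    unfolding fst[symmetric] by (rule \<eta>.prob_space_distr) simp
  let ?X = "\<lambda>z. fst z $ i" and ?Y = "\<lambda>z. snd z $ i"
  have X: "distr \<eta> borel ?X = distr \<mu> borel (\<lambda>x. x $ i)"
    unfolding fst[symmetric] by (subst distr_distr) (auto simp: comp_def)
  have X_atomless: "measure (distr \<eta> borel ?X) {r} = 0" for r
    unfolding X using i sets_\<mu> atomless by (rule distr_component_atomless)
  have AR: "AE z in \<eta>. z \<in> AR"
    using \<eta> by (rule treaty_AE_AR)
  have Y: "AE z in \<eta>. 0 \<le> ?Y z" "AE z in \<eta>. ?Y z \<le> ?X z"
    using AR by (eventually_elim; simp add: AR_def case_prod_unfold)+
  obtain g where g: "mono g" "\<And>x. 0 \<le> g x" "\<And>x. 0 \<le> x \<Longrightarrow> g x \<le> x"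
    and law: "distr \<eta> borel (\<lambda>z. g (?X z)) = distr \<eta> borel ?Y"
    using \<eta>.monotone_rearrangement_exists[OF _ _ X_atomless Y] by auto
  have [measurable]: "g \<in> borel_measurable borel"
    using g(1) by (rule borel_measurable_mono)
  let ?f = "\<lambda>x :: real ^ 'n. vec (g (x $ i)) :: real ^ 'n"
  let ?\<theta> = "distr \<mu> borel (\<lambda>x. (x, ?f x))"
  have \<theta>_prob: "prob_space ?\<theta>"
    by (rule \<mu>.prob_space_distr) simp
  have \<theta>_fst: "distr ?\<theta> borel fst = \<mu>"
    using sets_\<mu> by (subst distr_distr) (auto simp: comp_def distr_id2)
  have "distr ?\<theta> borel snd = distr \<mu> borel ?f"
    by (subst distr_distr) (auto simp: comp_def)
  also have "\<dots> = distr (distr \<eta> borel (\<lambda>z. g (?X z))) borel vec"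
    unfolding fst[symmetric] by (subst (1 2) distr_distr) (auto simp: comp_def)
  also have "\<dots> = distr (distr \<eta> borel ?Y) borel vec"
    unfolding law ..
  also have "\<dots> = distr \<eta> borel snd"
    by (subst distr_distr) (auto simp: comp_def vec[symmetric])
  finally have \<theta>_snd: "distr ?\<theta> borel snd = distr \<eta> borel snd" .
  have "AE z in \<eta>. (fst z, ?f (fst z)) \<in> AR"
    using AR
  proof eventually_elim
    case (elim z)
    have "0 \<le> snd z $ i" "snd z $ i \<le> fst z $ i"
      using elim by (auto simp: AR_def case_prod_unfold)
    then have "g (fst z $ i) \<le> fst z $ i"
      by (intro g(3)) simp
    then have "g (fst z $ i) \<le> fst z $ j" for j
      using i[of j] by simp
    then show ?case
      using g(2) by (simp add: AR_def)
  qed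
  then have "AE x in \<mu>. (x, ?f x) \<in> AR"
    unfolding fst[symmetric] by (subst AE_distr_iff) auto
  then have "AE z in ?\<theta>. z \<in> AR"
    by (subst AE_distr_iff) auto
  then have "measure ?\<theta> AR = 1"
    using prob_space.AE_in_set_eq_1[OF \<theta>_prob, of AR] by simp
  then have "?\<theta> \<in> couplings \<mu> (distr \<eta> borel snd) \<inter> treaties \<mu>"
    using \<theta>_prob \<theta>_fst \<theta>_snd by (simp add: couplings_def treaties_def)
  with that g(1) show thesis
    by blast
qed

text \<open>The integral of $k(y)$ depends on $\nu$ alone, so only $h(x-y)$ matters. Both integrals of it can be
taken over $\eta$, because the graph measure is the image of $\eta$ under
$(x,y) \mapsto (x,g(x))$; this is how the one-dimensional optimality theorem applies.\<close>

lemma monotone_treaty_optimal: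
  fixes \<eta> :: "((real ^ 'n) \<times> (real ^ 'n)) measure" and i :: 'n and h k :: "real ^ 'n \<Rightarrow> real"
  assumes i: "\<And>j. j = i" and atomless: "\<And>x. measure \<mu> {x} = 0"
    and g: "mono g" and h: "strictly_convex h" and k: "k \<in> borel_measurable borel"
  defines "\<theta> \<equiv> distr \<mu> borel (\<lambda>x. (x, vec (g (x $ i))))"
  assumes \<theta>: "\<theta> \<in> couplings \<mu> \<nu>" and \<eta>: "\<eta> \<in> couplings \<mu> \<nu>"
    and h_int: "integrable \<theta> (\<lambda>z. h (fst z - snd z))" "integrable \<eta> (\<lambda>z. h (fst z - snd z))"
    and k_int: "integrable \<theta> (\<lambda>z. k (snd z))" "integrable \<eta> (\<lambda>z. k (snd z))"
  shows "(\<integral>z. h (fst z - snd z) + k (snd z) \<partial>\<theta>) \<le> (\<integral>z. h (fst z - snd z) + k (snd z) \<partial>\<eta>)"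
    and "(\<integral>z. h (fst z - snd z) + k (snd z) \<partial>\<eta>) \<le> (\<integral>z. h (fst z - snd z) + k (snd z) \<partial>\<theta>)
      \<Longrightarrow> AE z in \<eta>. snd z = vec (g (fst z $ i))"
proof -
  note vec = vec_unique_component[OF i]
  interpret \<eta>: prob_space \<eta>
    using \<eta> by (simp add: couplings_def)
  have sets[measurable_cong]: "sets \<eta> = sets borel" "sets \<theta> = sets borel"
    and fst: "distr \<eta> borel fst = \<mu>" and snd: "distr \<eta> borel snd = \<nu>" "distr \<theta> borel snd = \<nu>"
    using \<eta> \<theta> by (simp_all add: couplings_def)
  have sets_\<mu>[measurable_cong]: "sets \<mu> = sets borel"
    using fst by (metis sets_distr)
  note k[measurable]
  let ?X = "\<lambda>z. fst z $ i" and ?Y = "\<lambda>z. snd z $ i" and ?h = "\<lambda>r. h (vec r)"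
  have [measurable]: "g \<in> borel_measurable borel"
    using g by (rule borel_measurable_mono)
  have h_cont: "continuous_on UNIV h"
    using strictly_convex_imp_convex_on[OF h] by (intro convex_on_continuous) auto
  then have [measurable]: "h \<in> borel_measurable borel"
    by (rule borel_measurable_continuous_onI)
  have h_real: "strictly_convex ?h"
    unfolding strictly_convex_def
  proof (intro allI impI)
    fix x y t :: real
    assume *: "x \<noteq> y \<and> 0 < t \<and> t < 1"
    then have "(vec x :: real ^ 'n) \<noteq> vec y"
      by (auto simp: vec_eq_iff)
    moreover have "vec ((1 - t) *\<^sub>R x + t *\<^sub>R y) = (1 - t) *\<^sub>R (vec x :: real ^ 'n) + t *\<^sub>R vec y"
      by (simp add: vec_eq_iff)
    ultimately show "?h ((1 - t) *\<^sub>R x + t *\<^sub>R y) < (1 - t) * ?h x + t * ?h y"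
      using h * unfolding strictly_convex_def by metis
  qed
  have X: "distr \<eta> borel ?X = distr \<mu> borel (\<lambda>x. x $ i)"
    unfolding fst[symmetric] by (subst distr_distr) (auto simp: comp_def)
  have X_atomless: "measure (distr \<eta> borel ?X) {r} = 0" for r
    unfolding X using i sets_\<mu> atomless by (rule distr_component_atomless)
  have \<theta>_\<eta>: "\<theta> = distr \<eta> borel (\<lambda>z. (fst z, vec (g (?X z))))"
    unfolding \<theta>_def fst[symmetric] by (subst distr_distr) (auto simp: comp_def)
  have "distr \<eta> borel (\<lambda>z. g (?X z)) = distr (distr \<theta> borel snd) borel (\<lambda>y. y $ i)"
    unfolding \<theta>_\<eta> by (subst (1 2) distr_distr) (auto simp: comp_def)
  also have "\<dots> = distr (distr \<eta> borel snd) borel (\<lambda>y. y $ i)"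
    by (simp only: snd)
  also have "\<dots> = distr \<eta> borel ?Y"
    by (subst distr_distr) (auto simp: comp_def)
  finally have law: "distr \<eta> borel ?Y = distr \<eta> borel (\<lambda>z. g (?X z))" ..
  have h_diff: "h (x - y) = ?h (x $ i - y $ i)" for x y
    using vec[of "x - y"] by simp
  have int: "integrable \<eta> (\<lambda>z. ?h (?X z - ?Y z))" "integrable \<eta> (\<lambda>z. ?h (?X z - g (?X z)))"
    using h_int unfolding \<theta>_\<eta> by (simp_all add: integrable_distr_eq h_diff)
  have k_eq: "(\<integral>z. k (snd z) \<partial>\<theta>) = (\<integral>z. k (snd z) \<partial>\<eta>)"
    using integral_distr[of snd \<eta> borel k] integral_distr[of snd \<theta> borel k] snd by simp
  have \<theta>_int: "(\<integral>z. h (fst z - snd z) \<partial>\<theta>) = (\<integral>z. ?h (?X z - g (?X z)) \<partial>\<eta>)"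
    unfolding \<theta>_\<eta> by (simp add: integral_distr h_diff)
  have \<eta>_int: "(\<integral>z. h (fst z - snd z) \<partial>\<eta>) = (\<integral>z. ?h (?X z - ?Y z) \<partial>\<eta>)"
    by (simp add: h_diff)
  have X_meas: "?X \<in> borel_measurable \<eta>" and Y_meas: "?Y \<in> borel_measurable \<eta>"
    by measurable
  note opt = \<eta>.monotone_coupling_optimal[OF X_meas Y_meas g h_real X_atomless law int]
  show "(\<integral>z. h (fst z - snd z) + k (snd z) \<partial>\<theta>) \<le> (\<integral>z. h (fst z - snd z) + k (snd z) \<partial>\<eta>)"
    using opt(1) h_int k_int by (simp add: k_eq \<theta>_int \<eta>_int)
  assume "(\<integral>z. h (fst z - snd z) + k (snd z) \<partial>\<eta>) \<le> (\<integral>z. h (fst z - snd z) + k (snd z) \<partial>\<theta>)"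
  then have "AE z in \<eta>. ?Y z = g (?X z)"
    using opt(2) h_int k_int by (simp add: k_eq \<theta>_int \<eta>_int)
  then show "AE z in \<eta>. snd z = vec (g (fst z $ i))"
    by eventually_elim (metis vec)
qed

section \<open>Optimal treaties are deterministic\<close>

theorem proposition5p4:
  fixes \<mu> :: "(real ^ 'n) measure"
    and S :: "((real ^ 'n) \<times> (real ^ 'n)) measure set"
    and P :: "((real ^ 'n) \<times> (real ^ 'n)) measure \<Rightarrow> real"
    and P1 P2 :: "(real ^ 'n) measure \<Rightarrow> real"
    and h k :: "((real ^ 'n) \<times> (real ^ 'n)) measure \<Rightarrow> real ^ 'n \<Rightarrow> real"
    and p :: "((real ^ 'n) \<times> (real ^ 'n)) measure \<Rightarrow> (real ^ 'n) \<times> (real ^ 'n) \<Rightarrow> real"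
  assumes "loss_distribution \<mu>"
    and "closedin (weak_topology (treaties \<mu>)) S"
    and "lower_semicontinuous_map (weak_topology (treaties \<mu>)) P"
    and "\<And>\<eta>. \<eta> \<in> treaties \<mu> \<Longrightarrow>
           P \<eta> = P1 (distr \<eta> borel (\<lambda>(x, y). x - y)) + P2 (distr \<eta> borel snd)"
    and "assumption_A2_with S (\<lambda>\<eta>. P1 (distr \<eta> borel (\<lambda>(x, y). x - y))) (\<lambda>\<eta> (x, y). h \<eta> (x - y))"
    and "assumption_A2_with S (\<lambda>\<eta>. P2 (distr \<eta> borel snd)) (\<lambda>\<eta> (x, y). k \<eta> y)"
    and "assumption_A1 S P"
    and p_eq: "\<And>\<eta> x y. p \<eta> (x, y) = h \<eta> (x - y) + k \<eta> y"
  shows "assumption_A2_with S P p \<and>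
    (CARD('n) = 1 \<and>
     (\<forall>\<nu> \<in> (\<lambda>\<eta>. distr \<eta> borel snd) ` S. couplings \<mu> \<nu> \<inter> treaties \<mu> \<subseteq> S) \<and>
     (\<forall>\<eta>'. optimal_treaty P S \<eta>' \<longrightarrow> strictly_convex (h \<eta>')) \<and>
     (\<forall>x. measure \<mu> {x} = 0)
     \<longrightarrow>
     (\<forall>\<eta>'. optimal_treaty P S \<eta>' \<longrightarrow>
        (\<forall>\<nu> \<in> (\<lambda>\<eta>. distr \<eta> borel snd) ` S.
           \<exists>g. optimal_monge_map S (constrained_cost (p \<eta>')) \<mu> \<nu> g \<and>
               (\<forall>g'. optimal_monge_map S (constrained_cost (p \<eta>')) \<mu> \<nu> g' \<longrightarrow>
                     (AE x in \<mu>. g' x = g x)))) \<and>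
     (\<forall>\<eta>'. optimal_treaty P S \<eta>' \<longrightarrow> deterministic \<mu> \<eta>'))"
proof -
  have S: "S \<subseteq> treaties \<mu>"
    using closedin_subset[OF assms(2)] by simp
  have prob: "prob_space \<eta>" if "\<eta> \<in> treaties \<mu>" for \<eta>
    using that by (simp add: treaties_def)
  have p: "p = (\<lambda>\<eta> z. (\<lambda>(x, y). h \<eta> (x - y)) z + (\<lambda>(x, y). k \<eta> y) z)"
    by (auto simp: fun_eq_iff p_eq)
  have A2: "assumption_A2_with S P p"
    unfolding p using assms(5,6)
    by (rule assumption_A2_add[OF prob mixture_treaty S assms(4), rotated 6])
  have \<mu>_sets: "sets \<mu> = sets borel"
    using assms(1) by (simp add: loss_distribution_def)
  show ?thesis
  proof (intro conjI impI allI ballI A2)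
    assume *: "CARD('n) = 1 \<and>
     (\<forall>\<nu> \<in> (\<lambda>\<eta>. distr \<eta> borel snd) ` S. couplings \<mu> \<nu> \<inter> treaties \<mu> \<subseteq> S) \<and>
     (\<forall>\<eta>'. optimal_treaty P S \<eta>' \<longrightarrow> strictly_convex (h \<eta>')) \<and>
     (\<forall>x. measure \<mu> {x} = 0)"
    obtain i :: 'n where i: "\<And>j. j = i"
      using * by (auto simp: card_1_singleton_iff)
    fix \<eta>' assume opt: "optimal_treaty P S \<eta>'"
    then have \<eta>': "\<eta>' \<in> S" and h: "strictly_convex (h \<eta>')"
      using * by (auto simp: optimal_treaty_def)
    have int_h: "integrable \<eta> (\<lambda>z. h \<eta>' (fst z - snd z))" and int_k: "integrable \<eta> (\<lambda>z. k \<eta>' (snd z))"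
      and int_p: "integrable \<eta> (p \<eta>')" if "\<eta> \<in> S" for \<eta>
      using assms(5,6) A2 \<eta>' that by (auto simp: assumption_A2_with_def case_prod_unfold)
    have "(\<lambda>z. k \<eta>' (snd z)) \<in> borel_measurable (borel :: ((real ^ 'n) \<times> (real ^ 'n)) measure)"
      using assms(6) \<eta>' by (auto simp: assumption_A2_with_def case_prod_unfold)
    then have "(\<lambda>z. k \<eta>' (snd z)) \<circ> (\<lambda>y :: real ^ 'n. (0 :: real ^ 'n, y)) \<in> borel_measurable borel"
      by (rule measurable_comp[rotated]) (auto intro!: borel_measurable_continuous_onI continuous_intros)
    then have k: "k \<eta>' \<in> borel_measurable borel"
      by (simp add: comp_def)
    have p_int: "(\<integral>z. p \<eta>' z \<partial>\<eta>) = (\<integral>z. h \<eta>' (fst z - snd z) + k \<eta>' (snd z) \<partial>\<eta>)" for \<eta>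
      by (simp add: p case_prod_unfold)
    have cost: "ereal_integral \<eta> (constrained_cost (p \<eta>')) =
        ereal (\<integral>z. h \<eta>' (fst z - snd z) + k \<eta>' (snd z) \<partial>\<eta>)" if "\<eta> \<in> S" for \<eta>
      using treaty_constrained_cost[of \<eta> \<mu> "p \<eta>'"] int_p[OF that] S that by (auto simp: p_int)
    let ?I = "\<lambda>\<eta>. ereal_integral \<eta> (constrained_cost (p \<eta>'))"
    \<comment> \<open>For each ceded marginal the monotone treaty is optimal, and nothing off its graph is.\<close>
    have monotone: "\<exists>f \<in> borel_measurable borel.
        distr \<mu> borel (\<lambda>x. (x, f x)) \<in> couplings \<mu> (distr \<eta>\<^sub>0 borel snd) \<inter> S \<and>
        (\<forall>\<eta> \<in> couplings \<mu> (distr \<eta>\<^sub>0 borel snd) \<inter> S.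
          ?I (distr \<mu> borel (\<lambda>x. (x, f x))) \<le> ?I \<eta> \<and>
          (?I \<eta> \<le> ?I (distr \<mu> borel (\<lambda>x. (x, f x))) \<longrightarrow> (AE z in \<eta>. snd z = f (fst z))))"
      if "\<eta>\<^sub>0 \<in> S" for \<eta>\<^sub>0
    proof -
      have \<eta>\<^sub>0: "\<eta>\<^sub>0 \<in> treaties \<mu>"
        using that S by auto
      have atomless: "measure \<mu> {x} = 0" for x
        using * by simp
      obtain g where g: "mono g" and \<theta>: "distr \<mu> borel (\<lambda>x. (x, vec (g (x $ i)))) \<in>
          couplings \<mu> (distr \<eta>\<^sub>0 borel snd) \<inter> treaties \<mu>"
        using monotone_treaty_exists[OF i \<eta>\<^sub>0 atomless] by blast
      let ?\<theta> = "distr \<mu> borel (\<lambda>x. (x, vec (g (x $ i)) :: real ^ 'n))"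
      have \<theta>_S: "?\<theta> \<in> S"
        using * \<theta> that by blast
      show ?thesis
      proof (rule bexI[where x = "\<lambda>x. vec (g (x $ i))"], intro conjI ballI)
        show "?\<theta> \<in> couplings \<mu> (distr \<eta>\<^sub>0 borel snd) \<inter> S"
          using \<theta> \<theta>_S by simp
        show "(\<lambda>x :: real ^ 'n. vec (g (x $ i)) :: real ^ 'n) \<in> borel_measurable borel"
          using borel_measurable_mono[OF g]
          by (intro measurable_compose[OF _ vec_borel(1)] measurable_compose[OF vec_borel(2)])
        fix \<eta> assume \<eta>: "\<eta> \<in> couplings \<mu> (distr \<eta>\<^sub>0 borel snd) \<inter> S"
        note opt = monotone_treaty_optimal[OF i atomless g h k, of "distr \<eta>\<^sub>0 borel snd" \<eta>]
        show "?I ?\<theta> \<le> ?I \<eta>"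
          using opt(1) \<eta> \<theta> \<theta>_S int_h int_k by (simp add: cost)
        show "?I \<eta> \<le> ?I ?\<theta> \<longrightarrow> (AE z in \<eta>. snd z = vec (g (fst z $ i)))"
          using opt(2) \<eta> \<theta> \<theta>_S int_h int_k by (simp add: cost)
      qed
    qed
    show "\<exists>g. optimal_monge_map S (constrained_cost (p \<eta>')) \<mu> \<nu> g \<and>
               (\<forall>g'. optimal_monge_map S (constrained_cost (p \<eta>')) \<mu> \<nu> g' \<longrightarrow>
                     (AE x in \<mu>. g' x = g x))" if \<nu>: "\<nu> \<in> (\<lambda>\<eta>. distr \<eta> borel snd) ` S" for \<nu>
    proof -
      obtain \<eta>\<^sub>0 where \<eta>\<^sub>0: "\<eta>\<^sub>0 \<in> S" "\<nu> = distr \<eta>\<^sub>0 borel snd"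
        using \<nu> by blast
      obtain f where f[measurable]: "f \<in> borel_measurable borel"
        and \<theta>: "distr \<mu> borel (\<lambda>x. (x, f x)) \<in> couplings \<mu> \<nu> \<inter> S"
        and f_opt: "\<forall>\<eta> \<in> couplings \<mu> \<nu> \<inter> S. ?I (distr \<mu> borel (\<lambda>x. (x, f x))) \<le> ?I \<eta> \<and>
          (?I \<eta> \<le> ?I (distr \<mu> borel (\<lambda>x. (x, f x))) \<longrightarrow> (AE z in \<eta>. snd z = f (fst z)))"
        using monotone[OF \<eta>\<^sub>0(1)] unfolding \<eta>\<^sub>0(2)[symmetric] by (elim bexE conjE) (rule that)
      have "optimal_monge_map S (constrained_cost (p \<eta>')) \<mu> \<nu> f"
        using f \<theta> f_opt by (simp add: optimal_monge_map_def)
      moreover have "AE x in \<mu>. g' x = f x"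
        if "optimal_monge_map S (constrained_cost (p \<eta>')) \<mu> \<nu> g'" for g'
      proof -
        have [measurable]: "g' \<in> borel_measurable borel"
          and "distr \<mu> borel (\<lambda>x. (x, g' x)) \<in> couplings \<mu> \<nu> \<inter> S"
          and "?I (distr \<mu> borel (\<lambda>x. (x, g' x))) \<le> ?I (distr \<mu> borel (\<lambda>x. (x, f x)))"
          using that \<theta> by (simp_all add: optimal_monge_map_def)
        then have "AE z in distr \<mu> borel (\<lambda>x. (x, g' x)). snd z = f (fst z)"
          using f_opt by blast
        moreover note [measurable_cong] = \<mu>_sets
        ultimately show ?thesis
          by (subst (asm) AE_distr_iff) auto
      qed
      ultimately show ?thesis
        by blast
    qed
    show "deterministic \<mu> \<eta>'"
    proof -
      obtain f where f[measurable]: "f \<in> borel_measurable borel"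
        and \<theta>: "distr \<mu> borel (\<lambda>x. (x, f x)) \<in> couplings \<mu> (distr \<eta>' borel snd) \<inter> S"
        and f_opt: "\<forall>\<eta> \<in> couplings \<mu> (distr \<eta>' borel snd) \<inter> S. ?I (distr \<mu> borel (\<lambda>x. (x, f x))) \<le> ?I \<eta> \<and>
          (?I \<eta> \<le> ?I (distr \<mu> borel (\<lambda>x. (x, f x))) \<longrightarrow> (AE z in \<eta>. snd z = f (fst z)))"
        using monotone[OF \<eta>'] by (elim bexE conjE) (rule that)
      have \<eta>'_treaty: "\<eta>' \<in> treaties \<mu>"
        using \<eta>' S by auto
      \<comment> \<open>\<open>?\<theta>\<close> has the same ceded marginal as \<open>\<eta>'\<close>, so it competes with \<open>\<eta>'\<close> in two ways:
        it is no worse in the transport problem, and no better in the linearised problem.\<close>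
      let ?\<theta> = "distr \<mu> borel (\<lambda>x. (x, f x))"
      have "(\<integral>z. p \<eta>' z \<partial>\<eta>') \<le> (\<integral>z. p \<eta>' z \<partial>?\<theta>)"
        using S \<theta> by (intro optimal_first_order_condition[OF prob assms(7) A2 opt]) auto
      then have "?I \<eta>' \<le> ?I ?\<theta>"
        using \<eta>' \<theta> by (simp add: cost p_int)
      moreover have "\<eta>' \<in> couplings \<mu> (distr \<eta>' borel snd) \<inter> S"
        using \<eta>' \<eta>'_treaty by (simp add: couplings_def treaties_def)
      ultimately have "AE z in \<eta>'. snd z = f (fst z)"
        using f_opt by blast
      then show ?thesis
        using \<eta>'_treaty f eq_graph_measure[of \<eta>' \<mu> f] by (auto simp: deterministic_def treaties_def)
    qed
  qed
qed

end
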